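(* Let $\beta\ge1$. Let $g_0:\mathbb{R}^n\to\overline{\mathbb{R}}$ be proper and lsc, $h:\mathbb{R}^m\to\overline{\mathbb{R}}$ proper, lsc and nondecreasing, and let $g_i:\Xi\times\mathbb{R}^n\to\mathbb{R}$, $i=1,\dots,m$, be lsc (jointly in both arguments) with $g_i(\cdot,x)$ uniformly bounded on $\Xi$, locally uniformly in $x$. Put $G=(g_1,\dots,g_m)$, and for $\theta^\nu>0$ put $$G^\nu(\xi,x)=(g_1^\nu(\xi,x),\dots,g_m^\nu(\xi,x)),\qquad g_i^\nu(\xi,x)=\inf_{\zeta\in\Xi}\ g_i(\zeta,x)+\tfrac1{\beta\theta^\nu}\|\zeta-\xi\|_2^\beta .$$ Let $\mu,\mu^\nu\in\mathscr{P}_\beta(\Xi)$ with $d_{{\rm FM}(\beta)}(\mu^\nu,\mu)\to0$, let $\alpha\ge1$, and let $$\lambda^\nu\in(0,\infty)\to0,\qquad\theta^\nu\in(0,\infty)\to0,\qquad \tfrac1{\lambda^\nu}\big(\tfrac1{\theta^\nu}d_{{\rm FM}(\beta)}(\mu^\nu,\mu)\big)^\alpha\to0 .$$ Define $\phi(x)=g_0(x)+h(\mathbb{E}_\mu[G(\boldsymbol\xi,x)])$, $f(u,x)=g_0(x)+h(u+\mathbb{E}_\mu[G(\boldsymbol\xi,x)])+\iota_{\{0\}^m}(u)$ and $f^\nu(u,x)=g_0(x)+h(u+\mathbb{E}_{\mu^\nu}[G^\nu(\boldsymbol\xi,x)])+\tfrac1{\alpha\lambda^\nu}\|u\|_2^\alpha$,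 and suppose $\operatorname{argmin}\phi\ne\emptyset$. Then $f^\nu$ epi-converge to $f$, and: (a) $\inf f=\inf\phi$ and $\epsilon\text{-}\operatorname{argmin}f=\{0\}\times\epsilon\text{-}\operatorname{argmin}\phi$ for every $\epsilon\in[0,\infty)$; (b) $\limsup_\nu(\inf f^\nu)\le\inf f$; (c) if $\epsilon^\nu\in[0,\infty)\to\epsilon\in[0,\infty)$, then $\operatorname{LimOut}(\epsilon^\nu\text{-}\operatorname{argmin}f^\nu)\subseteq\epsilon\text{-}\operatorname{argmin}f$; (d) if $\epsilon^\nu\in[0,\infty)\to0$ and, for some infinite $N\subseteq\mathbb{N}$, points $(u^\nu,x^\nu)\in\epsilon^\nu\text{-}\operatorname{argmin}f^\nu$, $\nu\in N$, converge along $N$, then $\lim_{\nu\in N}(\inf f^\nu)=\inf f$; (e) $\inf f^\nu\to\inf f$ if and only if the functions $f^\nu$ are tight; (f) if $\inf f^\nu\to\inf f$, then for every $x_0\in\operatorname{argmin}\phi$ there exist $\epsilon^\nu\in[0,\infty)\to0$ with $(0,x_0)\in\operatorname{LimInn}(\epsilon^\nu\text{-}\operatorname{argmin}f^\nu)$; (g) if $\inf f^\nu\to\inf f$, then there exist $\epsilon^\nu\in[0,\infty)\to0$ such that $\operatorname{Lim}(\epsilon^\nu\text{-}\operatorname{argmin}f^\nu)=\operatorname{argmin}f$.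
   Context: $\Xi\subseteq\mathbb{R}^d$ is nonempty and closed; $\mathscr{P}_\beta(\Xi)$ is the set of Borel probability measures $\mu$ on $\Xi$ with $\int_\Xi\|\xi\|_2^\beta\,\mu(d\xi)<\infty$; $\overline{\mathbb{R}}=[-\infty,\infty]$; lsc = lower semicontinuous; proper = never $-\infty$ and not identically $\infty$; $h$ nondecreasing means $h(y)\ge h(z)$ whenever $y\ge z$ componentwise. $\iota_C=0$ on $C$, $\infty$ off $C$. "$g_i(\cdot,x)$ uniformly bounded on $\Xi$, locally uniformly in $x$" means: for every $x\in\mathbb{R}^n$ there are $\epsilon_x>0$, $M_x<\infty$ with $|g_i(\xi,y)|\le M_x$ for all $\xi\in\Xi$ and $\|y-x\|_2\le\epsilon_x$. The $\beta$th-order Fortet-Mourier metric is $d_{{\rm FM}(\beta)}(\mu_1,\mu_2)=\sup\big|\int_\Xi\ell\,d(\mu_1-\mu_2)\big|$ over all $\ell:\Xi\to\mathbb{R}$ with $|\ell(\xi_1)-\ell(\xi_2)|\le\max\{1,\|\xi_1\|_2,\|\xi_2\|_2\}^{\beta-1}\|\xi_1-\xi_2\|_2$ for all $\xi_1,\xi_2\in\Xi$. For $\psi:\mathbb{R}^k\to\overline{\mathbb{R}}$: $\operatorname{dom}\psi=\{\psi<\infty\}$, $\operatorname{argmin}\psi=\{z\in\operatorname{dom}\psi:\psi(z)=\inf\psi\}$, $\epsilon\text{-}\operatorname{argmin}\psi=\{z\in\operatorname{dom}\psi:\psi(z)\le\inf\psi+\epsilon\}$. For sets $C^\nu\subseteq\mathbb{R}^k$: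 $\operatorname{LimOut}C^\nu$ is the set of limits of sequences $z^\nu\in C^\nu$, $\nu\in N$, over infinite $N\subseteq\mathbb{N}$; $\operatorname{LimInn}C^\nu$ is the set of limits of sequences $z^\nu\in C^\nu$, $\nu\in\mathbb{N}$; $\operatorname{Lim}C^\nu=C$ means both equal $C$. $\psi^\nu$ epi-converge to $\psi$ if for every $z$: $\liminf\psi^\nu(z^\nu)\ge\psi(z)$ for all $z^\nu\to z$ and $\limsup\psi^\nu(z^\nu)\le\psi(z)$ for some $z^\nu\to z$. The $\psi^\nu$ are tight if for every $\epsilon>0$ there are a compact $S_\epsilon$ and $\nu_\epsilon$ with $\inf_{S_\epsilon}\psi^\nu\le\inf\psi^\nu+\epsilon$ for all $\nu\ge\nu_\epsilon$.
   Formalization: LimInn is read with z^ν in C^ν for all sufficiently large ν rather than for every ν; with the literal reading (f) and (g) fail when some single f^ν has infimum −∞ (e.g. h(y)=y, g=0, α=1, λ^1=2), since its ε-argmin is then empty. *)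

theory Defs
  imports "HOL-Analysis.Analysis" "HOL-Probability.Probability"
begin

section \<open>Extended-real-valued functions\<close>

definition proper :: "('a \<Rightarrow> ereal) \<Rightarrow> bool" where
  "proper \<psi> \<longleftrightarrow> (\<forall>z. \<psi> z \<noteq> -\<infinity>) \<and> (\<exists>z. \<psi> z \<noteq> \<infinity>)"

text \<open>The filter \<open>at z within S\<close> is punctured; as the value at \<open>z\<close> itself trivially satisfies
  \<open>\<psi> z \<le> \<psi> z\<close>, this is the usual \<open>liminf \<psi> w \<ge> \<psi> z\<close> over \<open>w \<rightarrow> z\<close> in \<open>S\<close>.\<close>

definition lsc_on :: "'a::topological_space set \<Rightarrow> ('a \<Rightarrow> ereal) \<Rightarrow> bool" where
  "lsc_on S \<psi> \<longleftrightarrow> (\<forall>z\<in>S. \<psi> z \<le> Liminf (at z within S) \<psi>)"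

definition edom :: "('a \<Rightarrow> ereal) \<Rightarrow> 'a set" where
  "edom \<psi> = {z. \<psi> z < \<infinity>}"

definition argmin :: "('a \<Rightarrow> ereal) \<Rightarrow> 'a set" where
  "argmin \<psi> = {z \<in> edom \<psi>. \<psi> z = (INF w. \<psi> w)}"

definition eps_argmin :: "real \<Rightarrow> ('a \<Rightarrow> ereal) \<Rightarrow> 'a set" where
  "eps_argmin \<epsilon> \<psi> = {z \<in> edom \<psi>. \<psi> z \<le> (INF w. \<psi> w) + ereal \<epsilon>}"

definition iota :: "'a set \<Rightarrow> 'a \<Rightarrow> ereal" where
  "iota C z = (if z \<in> C then 0 else \<infinity>)"

section \<open>Set limits, epi-convergence, tightness\<close>

text \<open>Convergence along an index set \<open>N\<close>; meaningful for infinite \<open>N\<close>, where the filter is proper.\<close>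

definition along :: "nat set \<Rightarrow> nat filter" where
  "along N = inf sequentially (principal N)"

definition LimOut :: "(nat \<Rightarrow> 'a::topological_space set) \<Rightarrow> 'a set" where
  "LimOut C = {z. \<exists>N w. infinite N \<and> (\<forall>\<nu>\<in>N. w \<nu> \<in> C \<nu>) \<and> (w \<longlongrightarrow> z) (along N)}"

text \<open>As usual for Painleve-Kuratowski inner limits, a sequence has to lie in the sets only from
  some index on, so that finitely many empty \<open>C \<nu>\<close> do not affect the limit.  When all \<open>C \<nu>\<close> are
  nonempty this is the set of limits of sequences with \<open>w \<nu> \<in> C \<nu>\<close> for every \<open>\<nu>\<close>
  (\<open>LimInn_eq\<close> below).\<close>

definition LimInn :: "(nat \<Rightarrow> 'a::topological_space set) \<Rightarrow> 'a set" where
  "LimInn C = {z. \<exists>w. (\<forall>\<^sub>F \<nu> in sequentially. w \<nu> \<in> C \<nu>) \<and> w \<longlonglongrightarrow> z}"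

lemma LimInn_eq:
  assumes "\<And>\<nu>. C \<nu> \<noteq> {}"
  shows "LimInn C = {z. \<exists>w. (\<forall>\<nu>. w \<nu> \<in> C \<nu>) \<and> w \<longlonglongrightarrow> z}"
proof -
  have "\<exists>v. (\<forall>\<nu>. v \<nu> \<in> C \<nu>) \<and> v \<longlonglongrightarrow> z"
    if w: "\<forall>\<^sub>F \<nu> in sequentially. w \<nu> \<in> C \<nu>" "w \<longlonglongrightarrow> z" for w z
  proof -
    define v where "v = (\<lambda>\<nu>. if w \<nu> \<in> C \<nu> then w \<nu> else SOME y. y \<in> C \<nu>)"
    have "\<forall>\<nu>. v \<nu> \<in> C \<nu>"
      using assms by (auto simp: v_def some_in_eq)
    moreover have "\<forall>\<^sub>F \<nu> in sequentially. w \<nu> = v \<nu>"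
      using w(1) by eventually_elim (simp add: v_def)
    then have "v \<longlonglongrightarrow> z"
      using w(2) by (rule Lim_transform_eventually[rotated])
    ultimately show ?thesis by blast
  qed
  then show ?thesis
    unfolding LimInn_def by (auto intro: always_eventually)
qed

definition Lim_eq :: "(nat \<Rightarrow> 'a::topological_space set) \<Rightarrow> 'a set \<Rightarrow> bool" where
  "Lim_eq C D \<longleftrightarrow> LimOut C = D \<and> LimInn C = D"

definition epi_converges ::
    "(nat \<Rightarrow> 'a::topological_space \<Rightarrow> ereal) \<Rightarrow> ('a \<Rightarrow> ereal) \<Rightarrow> bool" where
  "epi_converges \<psi>s \<psi> \<longleftrightarrow> (\<forall>z.
     (\<forall>w. w \<longlonglongrightarrow> z \<longrightarrow> liminf (\<lambda>\<nu>. \<psi>s \<nu> (w \<nu>)) \<ge> \<psi> z) \<and>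
     (\<exists>w. w \<longlonglongrightarrow> z \<and> limsup (\<lambda>\<nu>. \<psi>s \<nu> (w \<nu>)) \<le> \<psi> z))"

definition tight_funs :: "(nat \<Rightarrow> 'a::topological_space \<Rightarrow> ereal) \<Rightarrow> bool" where
  "tight_funs \<psi>s \<longleftrightarrow> (\<forall>\<epsilon>>0. \<exists>S \<nu>0. compact S \<and>
     (\<forall>\<nu>\<ge>\<nu>0. (INF z\<in>S. \<psi>s \<nu> z) \<le> (INF z. \<psi>s \<nu> z) + ereal \<epsilon>))"

section \<open>Probability measures and the Fortet-Mourier metric\<close>

text \<open>The measures live on the subspace \<open>\<Xi>\<close> itself (\<open>space \<mu> = \<Xi>\<close>), so that integrals only see
  the values of the integrand on \<open>\<Xi>\<close>.\<close>

definition prob_measures :: "real \<Rightarrow> 'a::euclidean_space set \<Rightarrow> 'a measure set" where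
  "prob_measures \<beta> \<Xi> = {\<mu>. prob_space \<mu> \<and> sets \<mu> = sets (restrict_space borel \<Xi>) \<and>
     integrable \<mu> (\<lambda>\<xi>. norm \<xi> powr \<beta>)}"

definition FM_class :: "real \<Rightarrow> 'a::euclidean_space set \<Rightarrow> ('a \<Rightarrow> real) set" where
  "FM_class \<beta> \<Xi> = {l. \<forall>\<xi>1\<in>\<Xi>. \<forall>\<xi>2\<in>\<Xi>. \<bar>l \<xi>1 - l \<xi>2\<bar> \<le>
     (Max {1, norm \<xi>1, norm \<xi>2}) powr (\<beta> - 1) * norm (\<xi>1 - \<xi>2)}"

text \<open>On \<open>prob_measures \<beta> \<Xi>\<close> the functions in \<open>FM_class \<beta> \<Xi>\<close> are integrable and the real
  supremum is over a bounded nonempty set (\<open>FM_class_integrable\<close>, \<open>bdd_above_FM\<close>,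
  \<open>FM_class_nonempty\<close> below).\<close>

definition d_FM :: "real \<Rightarrow> 'a::euclidean_space set \<Rightarrow> 'a measure \<Rightarrow> 'a measure \<Rightarrow> real" where
  "d_FM \<beta> \<Xi> \<mu>1 \<mu>2 =
     (SUP l\<in>FM_class \<beta> \<Xi>. \<bar>(\<integral>\<xi>. l \<xi> \<partial>\<mu>1) - (\<integral>\<xi>. l \<xi> \<partial>\<mu>2)\<bar>)"

lemma FM_class_nonempty: "FM_class \<beta> \<Xi> \<noteq> {}"
proof -
  have "(\<lambda>_. 0) \<in> FM_class \<beta> \<Xi>" by (simp add: FM_class_def)
  then show ?thesis by blast
qed

lemma FM_class_growth:
  assumes l: "l \<in> FM_class \<beta> \<Xi>" and "\<beta> \<ge> 1" "\<xi> \<in> \<Xi>" "\<xi>0 \<in> \<Xi>"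
  shows "\<bar>l \<xi> - l \<xi>0\<bar> \<le> 2 * (1 + norm \<xi> powr \<beta> + norm \<xi>0 powr \<beta>)"
proof -
  define M where "M = Max {1, norm \<xi>, norm \<xi>0}"
  have M: "1 \<le> M" "norm \<xi> \<le> M" "norm \<xi>0 \<le> M" by (auto simp: M_def)
  have "norm (\<xi> - \<xi>0) \<le> 2 * M"
    using norm_triangle_ineq4[of \<xi> \<xi>0] M by linarith
  then have "M powr (\<beta> - 1) * norm (\<xi> - \<xi>0) \<le> M powr (\<beta> - 1) * (2 * M)"
    by (intro mult_left_mono) auto
  also have "\<dots> = 2 * M powr \<beta>"
    using M(1) by (simp add: powr_diff)
  also have "M \<in> {1, norm \<xi>, norm \<xi>0}" unfolding M_def by (rule Max_in) auto
  then have "M powr \<beta> \<le> 1 + norm \<xi> powr \<beta> + norm \<xi>0 powr \<beta>"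
    by auto
  finally show ?thesis
    using l assms(3,4) unfolding FM_class_def M_def by fastforce
qed

lemma FM_class_continuous:
  assumes l: "l \<in> FM_class \<beta> \<Xi>" and "\<beta> \<ge> 1"
  shows "continuous_on \<Xi> l"
  unfolding continuous_on_def
proof
  fix z assume z: "z \<in> \<Xi>"
  have "((\<lambda>y. (max 1 (max (norm y) (norm z))) powr (\<beta> - 1) * norm (y - z)) \<longlongrightarrow>
      (max 1 (max (norm z) (norm z))) powr (\<beta> - 1) * norm (z - z)) (at z within \<Xi>)"
    by (intro tendsto_intros) auto
  then have "((\<lambda>y. (max 1 (max (norm y) (norm z))) powr (\<beta> - 1) * norm (y - z)) \<longlongrightarrow> 0)
      (at z within \<Xi>)"
    by simp
  moreover have "\<forall>\<^sub>F y in at z within \<Xi>. norm (l y - l z) \<le>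
      (max 1 (max (norm y) (norm z))) powr (\<beta> - 1) * norm (y - z)"
    unfolding eventually_at_filter
  proof (intro always_eventually allI impI)
    fix y assume "y \<in> \<Xi>"
    then have "\<bar>l y - l z\<bar> \<le> (Max {1, norm y, norm z}) powr (\<beta> - 1) * norm (y - z)"
      using l z unfolding FM_class_def by blast
    then show "norm (l y - l z) \<le> (max 1 (max (norm y) (norm z))) powr (\<beta> - 1) * norm (y - z)"
      by simp
  qed
  ultimately have "((\<lambda>y. l y - l z) \<longlongrightarrow> 0) (at z within \<Xi>)"
    by (intro Lim_null_comparison[where f = "\<lambda>y. l y - l z"]) simp_all
  then show "(l \<longlongrightarrow> l z) (at z within \<Xi>)"
    by (simp add: LIM_zero_iff)
qed

lemma FM_class_integrable:
  assumes "\<beta> \<ge> 1" "\<mu> \<in> prob_measures \<beta> \<Xi>" "l \<in> FM_class \<beta> \<Xi>"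
  shows "integrable \<mu> l"
proof -
  interpret prob_space \<mu> using assms(2) by (simp add: prob_measures_def)
  have sets: "sets \<mu> = sets (restrict_space borel \<Xi>)"
    and int: "integrable \<mu> (\<lambda>\<xi>. norm \<xi> powr \<beta>)"
    using assms(2) by (auto simp: prob_measures_def)
  have sp: "space \<mu> = \<Xi>"
    using sets_eq_imp_space_eq[OF sets] by (simp add: space_restrict_space)
  obtain \<xi>0 where \<xi>0: "\<xi>0 \<in> \<Xi>" using not_empty sp by auto
  have "l \<in> borel_measurable \<mu>"
    using borel_measurable_continuous_on_restrict[OF FM_class_continuous[OF assms(3,1)]]
    by (simp cong: measurable_cong_sets add: measurable_cong_sets[OF sets refl])
  moreover have "integrable \<mu> (\<lambda>\<xi>. 2 * (1 + norm \<xi> powr \<beta> + norm \<xi>0 powr \<beta>) + \<bar>l \<xi>0\<bar>)"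
    using int by simp
  moreover have "AE \<xi> in \<mu>. norm (l \<xi>) \<le>
      norm (2 * (1 + norm \<xi> powr \<beta> + norm \<xi>0 powr \<beta>) + \<bar>l \<xi>0\<bar>)"
  proof (rule AE_I2)
    fix \<xi> assume "\<xi> \<in> space \<mu>"
    then have "\<bar>l \<xi> - l \<xi>0\<bar> \<le> 2 * (1 + norm \<xi> powr \<beta> + norm \<xi>0 powr \<beta>)"
      using FM_class_growth[OF assms(3,1) _ \<xi>0, of \<xi>] sp by simp
    then show "norm (l \<xi>) \<le> norm (2 * (1 + norm \<xi> powr \<beta> + norm \<xi>0 powr \<beta>) + \<bar>l \<xi>0\<bar>)"
      unfolding real_norm_def by linarith
  qed
  ultimately show ?thesis
    using Bochner_Integration.integrable_bound by blast
qed

lemma bdd_above_FM: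
  assumes "\<beta> \<ge> 1" "\<mu>1 \<in> prob_measures \<beta> \<Xi>" "\<mu>2 \<in> prob_measures \<beta> \<Xi>"
  shows "bdd_above ((\<lambda>l. \<bar>(\<integral>\<xi>. l \<xi> \<partial>\<mu>1) - (\<integral>\<xi>. l \<xi> \<partial>\<mu>2)\<bar>) ` FM_class \<beta> \<Xi>)"
proof -
  have sp: "space \<mu> = \<Xi>" if "\<mu> \<in> prob_measures \<beta> \<Xi>" for \<mu>
    using that sets_eq_imp_space_eq[of \<mu> "restrict_space borel \<Xi>"]
    by (simp add: prob_measures_def space_restrict_space)
  obtain \<xi>0 where \<xi>0: "\<xi>0 \<in> \<Xi>"
    using prob_space.not_empty[of \<mu>1] assms(2) sp[OF assms(2)]
    unfolding prob_measures_def by blast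
  have *: "\<bar>(\<integral>\<xi>. l \<xi> \<partial>\<mu>) - l \<xi>0\<bar> \<le>
      (\<integral>\<xi>. 2 * (1 + norm \<xi> powr \<beta> + norm \<xi>0 powr \<beta>) \<partial>\<mu>)"
    if \<mu>: "\<mu> \<in> prob_measures \<beta> \<Xi>" and l: "l \<in> FM_class \<beta> \<Xi>" for \<mu> l
  proof -
    interpret prob_space \<mu> using \<mu> by (simp add: prob_measures_def)
    have int: "integrable \<mu> (\<lambda>\<xi>. norm \<xi> powr \<beta>)"
      using \<mu> by (auto simp: prob_measures_def)
    note il = FM_class_integrable[OF assms(1) \<mu> l]
    have "(\<integral>\<xi>. l \<xi> \<partial>\<mu>) - l \<xi>0 = (\<integral>\<xi>. l \<xi> - l \<xi>0 \<partial>\<mu>)"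
      using il by (simp add: prob_space)
    also have "\<bar>\<dots>\<bar> \<le> (\<integral>\<xi>. \<bar>l \<xi> - l \<xi>0\<bar> \<partial>\<mu>)"
      by (rule integral_abs_bound)
    also have "\<dots> \<le> (\<integral>\<xi>. 2 * (1 + norm \<xi> powr \<beta> + norm \<xi>0 powr \<beta>) \<partial>\<mu>)"
      using il int FM_class_growth[OF l assms(1) _ \<xi>0] sp[OF \<mu>]
      by (intro integral_mono) auto
    finally show ?thesis .
  qed
  show ?thesis
  proof (rule bdd_aboveI2)
    fix l assume l: "l \<in> FM_class \<beta> \<Xi>"
    show "\<bar>(\<integral>\<xi>. l \<xi> \<partial>\<mu>1) - (\<integral>\<xi>. l \<xi> \<partial>\<mu>2)\<bar> \<le>
        (\<integral>\<xi>. 2 * (1 + norm \<xi> powr \<beta> + norm \<xi>0 powr \<beta>) \<partial>\<mu>1) +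
        (\<integral>\<xi>. 2 * (1 + norm \<xi> powr \<beta> + norm \<xi>0 powr \<beta>) \<partial>\<mu>2)"
      using *[OF assms(2) l] *[OF assms(3) l] by linarith
  qed
qed

end

theory Submission
  imports Defs
begin

text \<open>For \<open>\<bar>q\<bar> \<le> M\<close>, near-minimisers in the inf-convolution defining \<open>g\<^sub>i\<^sup>\<nu>\<close> stay within a fixed
  distance of \<open>\<xi>\<close>, so \<open>\<theta>\<^sup>\<nu> g\<^sub>i\<^sup>\<nu>\<close> lies, up to a constant factor, in the Fortet-Mourier class.
  Hence replacing \<open>\<mu>\<^sup>\<nu>\<close> by \<open>\<mu>\<close> in the expectation costs at most a multiple of
  \<open>\<rho>\<^sup>\<nu> = d(\<mu>\<^sup>\<nu>, \<mu>) / \<theta>\<^sup>\<nu>\<close>, which tends to \<open>0\<close>.  The liminf inequality follows since the \<open>g\<^sub>i\<^sup>\<nu>\<close>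
  converge to \<open>g\<^sub>i\<close> from below and \<open>h\<close> is monotone and lsc; the recovery sequence
  \<open>u\<^sup>\<nu> = - C \<rho>\<^sup>\<nu> (1, \<dots>, 1)\<close> absorbs the error, with penalty of order \<open>(\<rho>\<^sup>\<nu>)\<^sup>\<alpha> / \<lambda>\<^sup>\<nu>\<close>, which vanishes by
  the rate assumption.  Parts (b) to (g) are then general consequences of epi-convergence.\<close>

section \<open>Consequences of epi-convergence\<close>

lemma eventually_along: "eventually P (along N) \<longleftrightarrow> (\<forall>\<^sub>F n in sequentially. n \<in> N \<longrightarrow> P n)"
  by (simp add: along_def eventually_inf_principal)

lemma eventually_along_mem: "\<forall>\<^sub>F n in along N. n \<in> N"
  by (simp add: eventually_along)

lemma along_le_sequentially: "along N \<le> sequentially"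
  by (simp add: along_def)

lemma along_UNIV: "along UNIV = sequentially"
  by (simp add: along_def)

lemma along_neq_bot:
  assumes "infinite N" shows "along N \<noteq> bot"
proof
  assume "along N = bot"
  then obtain n0 where "\<And>n. n \<ge> n0 \<Longrightarrow> n \<notin> N"
    by (auto simp: eventually_False[symmetric] eventually_along eventually_sequentially)
  then have "N \<subseteq> {..<n0}" by (meson lessThan_iff not_le subsetI)
  then show False using assms finite_subset by blast
qed

lemma epi_liminf_along:
  assumes epi: "epi_converges fs f" and w: "(w \<longlongrightarrow> z) (along N)" and c: "c < f z"
  shows "\<forall>\<^sub>F n in along N. c < fs n (w n)"
proof -
  define w' where "w' n = (if n \<in> N then w n else z)" for n
  have "w' \<longlonglongrightarrow> z"
  proof (rule topological_tendstoI)
    fix S assume "open S" "z \<in> S"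
    with w have "\<forall>\<^sub>F n in along N. w n \<in> S" by (rule topological_tendstoD)
    then show "\<forall>\<^sub>F n in sequentially. w' n \<in> S"
      unfolding eventually_along by eventually_elim (use \<open>z \<in> S\<close> in \<open>auto simp: w'_def\<close>)
  qed
  then have "f z \<le> liminf (\<lambda>n. fs n (w' n))"
    using epi by (auto simp: epi_converges_def)
  with c have "\<forall>\<^sub>F n in sequentially. c < fs n (w' n)"
    by (intro less_LiminfD) auto
  then show ?thesis
    unfolding eventually_along by eventually_elim (auto simp: w'_def)
qed

lemma epi_liminf:
  assumes "epi_converges fs f" "w \<longlonglongrightarrow> z" "c < f z"
  shows "\<forall>\<^sub>F n in sequentially. c < fs n (w n)"
  using epi_liminf_along[of fs f w z UNIV c] assms by (simp add: along_UNIV)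

lemma epi_limsup:
  assumes "epi_converges fs f"
  obtains w where "w \<longlonglongrightarrow> z" "\<And>c. f z < c \<Longrightarrow> \<forall>\<^sub>F n in sequentially. fs n (w n) < c"
proof -
  obtain w where w: "w \<longlonglongrightarrow> z" "limsup (\<lambda>n. fs n (w n)) \<le> f z"
    using assms unfolding epi_converges_def by blast
  show ?thesis
    by (rule that[OF w(1)]) (use w(2) in \<open>simp add: Limsup_le_iff\<close>)
qed

lemma epi_limsup_inf:
  assumes "epi_converges fs f"
  shows "limsup (\<lambda>n. INF z. fs n z) \<le> (INF z. f z)"
proof (rule INF_greatest)
  fix z
  obtain w where w: "w \<longlonglongrightarrow> z" "\<And>c. f z < c \<Longrightarrow> \<forall>\<^sub>F n in sequentially. fs n (w n) < c"
    using epi_limsup[OF assms] by blast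
  show "limsup (\<lambda>n. INF z. fs n z) \<le> f z"
    unfolding Limsup_le_iff
  proof (intro allI impI)
    fix c assume "f z < c"
    then show "\<forall>\<^sub>F n in sequentially. (INF z. fs n z) < c"
      by (rule eventually_mono[OF w(2)]) (auto intro: le_less_trans[OF INF_lower])
  qed
qed

lemma epi_inf_less:
  assumes "epi_converges fs f" "(INF z. f z) < c"
  shows "\<forall>\<^sub>F n in sequentially. (INF z. fs n z) < c"
  using epi_limsup_inf[OF assms(1)] assms(2) by (simp add: Limsup_le_iff)

lemma epi_LimOut_eps_argmin:
  assumes epi: "epi_converges fs f" and m: "(INF z. f z) = ereal m" and \<epsilon>s: "\<epsilon>s \<longlonglongrightarrow> \<epsilon>"
  shows "LimOut (\<lambda>n. eps_argmin (\<epsilon>s n) (fs n)) \<subseteq> eps_argmin \<epsilon> f"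
proof
  fix z assume "z \<in> LimOut (\<lambda>n. eps_argmin (\<epsilon>s n) (fs n))"
  then obtain N w where N: "infinite N" and w: "\<And>n. n \<in> N \<Longrightarrow> w n \<in> eps_argmin (\<epsilon>s n) (fs n)"
    and lim: "(w \<longlongrightarrow> z) (along N)"
    by (auto simp: LimOut_def)
  have "f z \<le> ereal (m + \<epsilon>)"
  proof (rule ccontr)
    assume "\<not> ?thesis"
    then obtain c where c: "m + \<epsilon> < c" "ereal c < f z"
      using ereal_dense2[of "ereal (m + \<epsilon>)" "f z"] by (auto simp: not_le)
    define d where "d = (c - m - \<epsilon>) / 2"
    have d: "d > 0" "m + d + (\<epsilon> + d) = c" using c by (auto simp: d_def field_simps)
    have "\<forall>\<^sub>F n in along N. ereal c < fs n (w n)"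
      by (rule epi_liminf_along[OF epi lim c(2)])
    moreover have "\<forall>\<^sub>F n in along N. (INF z. fs n z) < ereal (m + d)"
      by (rule filter_leD[OF along_le_sequentially epi_inf_less[OF epi]]) (use d in \<open>simp add: m\<close>)
    moreover have "\<forall>\<^sub>F n in along N. \<epsilon>s n < \<epsilon> + d"
      by (rule filter_leD[OF along_le_sequentially order_tendstoD(2)[OF \<epsilon>s]]) (use d in simp)
    moreover note eventually_along_mem
    ultimately have "\<forall>\<^sub>F n in along N. False"
    proof eventually_elim
      case (elim n)
      have "fs n (w n) \<le> (INF z. fs n z) + ereal (\<epsilon>s n)"
        using w elim by (auto simp: eps_argmin_def)
      also have "\<dots> \<le> ereal (m + d) + ereal (\<epsilon> + d)"
        using elim by (intro add_mono) auto
      also have "\<dots> = ereal c" using d by simp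
      finally show False using elim by simp
    qed
    then show False using along_neq_bot[OF N] by (simp add: eventually_False)
  qed
  moreover have "\<dots> < \<infinity>" by simp
  ultimately show "z \<in> eps_argmin \<epsilon> f"
    unfolding eps_argmin_def edom_def m by (auto simp del: ereal_infty_less)
qed

lemma epi_inf_tendsto_along:
  assumes epi: "epi_converges fs f" and m: "(INF z. f z) = ereal m" and \<epsilon>s: "\<epsilon>s \<longlonglongrightarrow> 0"
    and w: "\<And>n. n \<in> N \<Longrightarrow> w n \<in> eps_argmin (\<epsilon>s n) (fs n)" and lim: "(w \<longlongrightarrow> z) (along N)"
  shows "((\<lambda>n. INF z. fs n z) \<longlongrightarrow> (INF z. f z)) (along N)"
proof (rule order_tendstoI)
  fix a assume "(INF z. f z) < a"
  from filter_leD[OF along_le_sequentially epi_inf_less[OF epi this]]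
  show "\<forall>\<^sub>F n in along N. (INF z. fs n z) < a" .
next
  fix a assume "a < (INF z. f z)"
  then obtain c where c: "a < ereal c" "c < m"
    using ereal_dense2[of a "ereal m"] by (auto simp: m)
  define d where "d = (m - c) / 2"
  have d: "d > 0" "c + d < m" using c by (auto simp: d_def field_simps)
  have "ereal m \<le> f z" unfolding m[symmetric] by (rule INF_lower) simp
  then have "ereal (c + d) < f z" using d by (auto intro: less_le_trans[rotated])
  then have "\<forall>\<^sub>F n in along N. ereal (c + d) < fs n (w n)"
    by (rule epi_liminf_along[OF epi lim])
  moreover have "\<forall>\<^sub>F n in along N. \<epsilon>s n < d"
    by (rule filter_leD[OF along_le_sequentially order_tendstoD(2)[OF \<epsilon>s]]) (use d in simp)
  moreover note eventually_along_mem
  ultimately show "\<forall>\<^sub>F n in along N. a < (INF z. fs n z)"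
  proof eventually_elim
    case (elim n)
    have "ereal c < (INF z. fs n z)"
    proof (rule ccontr)
      assume "\<not> ?thesis"
      then have "(INF z. fs n z) + ereal (\<epsilon>s n) \<le> ereal c + ereal d"
        using elim by (intro add_mono) auto
      moreover have "fs n (w n) \<le> (INF z. fs n z) + ereal (\<epsilon>s n)"
        using w elim by (auto simp: eps_argmin_def)
      ultimately show False using elim(1) by (auto dest: less_le_trans)
    qed
    with c(1) show ?case by (rule less_trans)
  qed
qed

lemma epi_inf_tendsto_imp_tight:
  fixes f :: "'a::heine_borel \<Rightarrow> ereal"
  assumes epi: "epi_converges fs f" and m: "(INF z. f z) = ereal m"
    and lim: "(\<lambda>n. INF z. fs n z) \<longlonglongrightarrow> (INF z. f z)"
  shows "tight_funs fs"
  unfolding tight_funs_def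
proof (intro allI impI)
  fix \<epsilon> :: real assume \<epsilon>: "\<epsilon> > 0"
  have "(INF z. f z) < ereal (m + \<epsilon> / 2)" using \<epsilon> by (simp add: m)
  then obtain z where "f z < ereal (m + \<epsilon> / 2)"
    by (auto simp: INF_less_iff)
  then obtain w where w: "w \<longlonglongrightarrow> z" and "\<forall>\<^sub>F n in sequentially. fs n (w n) < ereal (m + \<epsilon> / 2)"
    using epi_limsup[OF epi] by metis
  note this(2)
  moreover have "\<forall>\<^sub>F n in sequentially. ereal (m - \<epsilon> / 2) < (INF z. fs n z)"
    using \<epsilon> by (intro order_tendstoD(1)[OF lim]) (simp add: m)
  ultimately have "\<forall>\<^sub>F n in sequentially.
      (INF z\<in>insert z (range w). fs n z) \<le> (INF z. fs n z) + ereal \<epsilon>"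
  proof eventually_elim
    case (elim n)
    have "(INF z\<in>insert z (range w). fs n z) \<le> fs n (w n)" by (rule INF_lower) simp
    also have "\<dots> \<le> ereal (m + \<epsilon> / 2)" using elim by simp
    also have "\<dots> = ereal (m - \<epsilon> / 2) + ereal \<epsilon>" by (simp add: field_simps)
    also have "\<dots> \<le> (INF z. fs n z) + ereal \<epsilon>" using elim by (intro add_mono) auto
    finally show ?case .
  qed
  then show "\<exists>S n0. compact S \<and> (\<forall>n\<ge>n0. (INF z\<in>S. fs n z) \<le> (INF z. fs n z) + ereal \<epsilon>)"
    using compact_sequence_with_limit[OF w] unfolding eventually_sequentially by blast
qed

lemma epi_compact_inf_greater:
  fixes f :: "'a::first_countable_topology \<Rightarrow> ereal"
  assumes epi: "epi_converges fs f" and S: "compact S" and c: "c < (INF z. f z)"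
  shows "\<forall>\<^sub>F n in sequentially. c < (INF z\<in>S. fs n z)"
proof (rule ccontr)
  assume neg: "\<not> ?thesis"
  obtain b where b: "c < b" "b < (INF z. f z)" using dense[OF c] by blast
  define N where "N = {n. (INF z\<in>S. fs n z) \<le> c}"
  have "infinite N"
    using neg by (simp add: N_def frequently_cofinite[symmetric] cofinite_eq_sequentially
        frequently_def not_le)
  then obtain r :: "nat \<Rightarrow> nat" where r: "strict_mono r" "\<And>n. r n \<in> N"
    using infinite_enumerate by blast
  have "\<exists>z\<in>S. fs (r n) z < b" for n
    using r(2)[of n] b(1) by (auto simp: N_def INF_less_iff dest: le_less_trans)
  then obtain v where v: "\<And>n. v n \<in> S" "\<And>n. fs (r n) (v n) < b" by metis
  obtain z s where s: "strict_mono s" "(v \<circ> s) \<longlonglongrightarrow> z"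
    using S v(1) by (metis compact_imp_seq_compact seq_compactE)
  have rs: "strict_mono (r \<circ> s)" using r(1) s(1) by (rule strict_mono_o)
  define w where "w n = v (s (inv (r \<circ> s) n))" for n
  have inv: "inv (r \<circ> s) (r (s k)) = k" for k
    using inv_f_f[OF strict_mono_imp_inj_on[OF rs], of k] by simp
  have "(w \<longlongrightarrow> z) (along (range (r \<circ> s)))"
  proof (rule topological_tendstoI)
    fix U assume "open U" "z \<in> U"
    with s(2) have "\<forall>\<^sub>F n in sequentially. (v \<circ> s) n \<in> U" by (rule topological_tendstoD)
    then obtain k where k: "\<And>n. n \<ge> k \<Longrightarrow> v (s n) \<in> U" by (auto simp: eventually_sequentially)
    have "w n \<in> U" if "n \<ge> r (s k)" "n \<in> range (r \<circ> s)" for n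
      using that k rs inv by (auto simp: w_def strict_mono_less_eq[OF rs, unfolded comp_def])
    then show "\<forall>\<^sub>F n in along (range (r \<circ> s)). w n \<in> U"
      unfolding eventually_along eventually_sequentially by blast
  qed
  moreover have "b < f z" using b(2) by (rule less_le_trans) (simp add: INF_lower)
  ultimately have "\<forall>\<^sub>F n in along (range (r \<circ> s)). b < fs n (w n)"
    by (rule epi_liminf_along[OF epi])
  moreover note eventually_along_mem
  ultimately have "\<forall>\<^sub>F n in along (range (r \<circ> s)). False"
  proof eventually_elim
    case (elim n)
    then obtain k where n: "n = r (s k)" by auto
    have "w n = v (s k)" unfolding w_def n inv ..
    with elim(1) v(2)[of "s k"] show False by (simp add: n)
  qed
  moreover have "infinite (range (r \<circ> s))"
    using strict_mono_imp_inj_on[OF rs] by (rule range_inj_infinite)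
  ultimately show False using along_neq_bot by (auto simp: eventually_False)
qed

lemma epi_tight_imp_inf_tendsto:
  fixes f :: "'a::first_countable_topology \<Rightarrow> ereal"
  assumes epi: "epi_converges fs f" and m: "(INF z. f z) = ereal m" and tight: "tight_funs fs"
  shows "(\<lambda>n. INF z. fs n z) \<longlonglongrightarrow> (INF z. f z)"
proof (rule order_tendstoI)
  fix a assume "(INF z. f z) < a"
  then show "\<forall>\<^sub>F n in sequentially. (INF z. fs n z) < a" by (rule epi_inf_less[OF epi])
next
  fix a assume "a < (INF z. f z)"
  then obtain c where c: "a < ereal c" "c < m"
    using ereal_dense2[of a "ereal m"] by (auto simp: m)
  define d where "d = (m - c) / 2"
  have d: "d > 0" "c + d < m" using c by (auto simp: d_def field_simps)
  obtain S n0 where S: "compact S" "\<And>n. n \<ge> n0 \<Longrightarrow> (INF z\<in>S. fs n z) \<le> (INF z. fs n z) + ereal d"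
    using tight d(1) unfolding tight_funs_def by blast
  have "\<forall>\<^sub>F n in sequentially. ereal (c + d) < (INF z\<in>S. fs n z)"
    using d by (intro epi_compact_inf_greater[OF epi S(1)]) (simp add: m)
  then show "\<forall>\<^sub>F n in sequentially. a < (INF z. fs n z)"
    using eventually_ge_at_top[of n0]
  proof eventually_elim
    case (elim n)
    have "ereal c < (INF z. fs n z)"
    proof (rule ccontr)
      assume "\<not> ?thesis"
      then have "(INF z. fs n z) + ereal d \<le> ereal c + ereal d"
        by (intro add_mono) auto
      with S(2)[OF elim(2)] elim(1) show False by (auto dest: less_le_trans)
    qed
    with c(1) show ?case by (rule less_trans)
  qed
qed

lemma epi_argmin_LimInn:
  assumes epi: "epi_converges fs f" and m: "(INF z. f z) = ereal m"
    and lim: "(\<lambda>n. INF z. fs n z) \<longlonglongrightarrow> (INF z. f z)" and z: "z \<in> argmin f"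
  obtains \<epsilon>s where "\<And>n. \<epsilon>s n \<ge> 0" "\<epsilon>s \<longlonglongrightarrow> 0"
    "z \<in> LimInn (\<lambda>n. eps_argmin (\<epsilon>s n) (fs n))"
proof -
  obtain w where w: "w \<longlonglongrightarrow> z" "\<And>c. f z < c \<Longrightarrow> \<forall>\<^sub>F n in sequentially. fs n (w n) < c"
    using epi_limsup[OF epi] by blast
  have fz: "f z = ereal m" using z m by (simp add: argmin_def)
  have "(\<lambda>n. fs n (w n)) \<longlonglongrightarrow> ereal m"
    by (rule order_tendstoI) (use w epi_liminf[OF epi w(1)] in \<open>auto simp: fz\<close>)
  note l = this lim[unfolded m]
  define \<epsilon>s where "\<epsilon>s n = \<bar>real_of_ereal (fs n (w n)) - real_of_ereal (INF z. fs n z)\<bar>" for n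
  have "\<epsilon>s \<longlonglongrightarrow> \<bar>real_of_ereal (ereal m) - real_of_ereal (ereal m)\<bar>"
    unfolding \<epsilon>s_def using l by (intro tendsto_intros) auto
  then have "\<epsilon>s \<longlonglongrightarrow> 0" by simp
  moreover have "\<forall>\<^sub>F n in sequentially. w n \<in> eps_argmin (\<epsilon>s n) (fs n)"
    using order_tendstoD(1)[OF l(1), of "ereal (m - 1)", simplified]
      order_tendstoD(2)[OF l(1), of "ereal (m + 1)", simplified]
      order_tendstoD(1)[OF l(2), of "ereal (m - 1)", simplified]
      order_tendstoD(2)[OF l(2), of "ereal (m + 1)", simplified]
  proof eventually_elim
    case (elim n)
    then obtain a b where "fs n (w n) = ereal a" "(INF z. fs n z) = ereal b"
      by (cases "fs n (w n)"; cases "INF z. fs n z") auto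
    then show ?case by (simp add: eps_argmin_def edom_def \<epsilon>s_def)
  qed
  ultimately show ?thesis
    using that[of \<epsilon>s] w(1) by (auto simp: LimInn_def \<epsilon>s_def)
qed

lemma LimInn_closure:
  fixes C :: "nat \<Rightarrow> 'a::metric_space set"
  assumes z: "z \<in> closure (LimInn C)"
  shows "z \<in> LimInn C"
proof -
  have ev: "\<forall>\<^sub>F n in sequentially. \<exists>y\<in>C n. dist y z < e" if "e > 0" for e
  proof -
    obtain y where y: "y \<in> LimInn C" "dist y z < e / 2"
      using z \<open>e > 0\<close> by (auto simp: closure_approachable dest: spec[of _ "e / 2"])
    then obtain w where w: "\<forall>\<^sub>F n in sequentially. w n \<in> C n" "w \<longlonglongrightarrow> y"
      by (auto simp: LimInn_def)
    have "\<forall>\<^sub>F n in sequentially. dist (w n) y < e / 2"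
      using w(2) \<open>e > 0\<close> by (intro tendstoD) auto
    with w(1) show ?thesis
    proof eventually_elim
      case (elim n)
      have "dist (w n) z \<le> dist (w n) y + dist y z" by (rule dist_triangle)
      also have "\<dots> < e" using elim y(2) by simp
      finally show ?case using elim by blast
    qed
  qed
  define w where "w n = (SOME y. y \<in> C n \<and> dist z y < infdist z (C n) + 1 / Suc n)" for n
  have w: "w n \<in> C n \<and> dist z (w n) < infdist z (C n) + 1 / Suc n" if "C n \<noteq> {}" for n
  proof -
    have "(INF a\<in>C n. dist z a) < infdist z (C n) + 1 / Suc n"
      using that by (simp add: infdist_notempty)
    then have "\<exists>y. y \<in> C n \<and> dist z y < infdist z (C n) + 1 / Suc n"
      using cINF_less_iff[of "C n" "dist z"] that by (auto intro!: bdd_belowI[of _ 0])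
    then show ?thesis unfolding w_def by (rule someI_ex)
  qed
  have "\<forall>\<^sub>F n in sequentially. w n \<in> C n"
    using ev[of 1] by (rule eventually_mono) (use w in auto)
  moreover have "w \<longlonglongrightarrow> z"
  proof (rule tendstoI)
    fix e :: real assume "e > 0"
    then have "\<forall>\<^sub>F n in sequentially. 1 / Suc n < e / 2"
      using order_tendstoD(2)[OF LIMSEQ_Suc[OF lim_1_over_n], of "e / 2"] by simp
    moreover have "\<forall>\<^sub>F n in sequentially. \<exists>y\<in>C n. dist y z < e / 2"
      using \<open>e > 0\<close> by (intro ev) simp
    ultimately show "\<forall>\<^sub>F n in sequentially. dist (w n) z < e"
    proof eventually_elim
      case (elim n)
      then obtain y where y: "y \<in> C n" "dist z y < e / 2" by (auto simp: dist_commute)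
      then have "infdist z (C n) < e / 2" using infdist_le[OF y(1), of z] by simp
      then have "dist z (w n) < e" using w[of n] y(1) elim(1) by force
      then show ?case by (simp add: dist_commute)
    qed
  qed
  ultimately show ?thesis by (auto simp: LimInn_def)
qed

lemma LimInn_subset_LimOut: "LimInn C \<subseteq> LimOut C"
proof
  fix z assume "z \<in> LimInn C"
  then obtain w n0 where w: "\<And>n. n \<ge> n0 \<Longrightarrow> w n \<in> C n" "w \<longlonglongrightarrow> z"
    by (auto simp: LimInn_def eventually_sequentially)
  have "(w \<longlongrightarrow> z) (along {n0..})"
    by (rule tendsto_mono[OF along_le_sequentially w(2)])
  then show "z \<in> LimOut C"
    using w(1) infinite_Ici[of n0] unfolding LimOut_def by blast
qed

lemma LimInn_mono:
  assumes "\<forall>\<^sub>F n in sequentially. C n \<subseteq> D n"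
  shows "LimInn C \<subseteq> LimInn D"
proof
  fix z assume "z \<in> LimInn C"
  then obtain w where w: "\<forall>\<^sub>F n in sequentially. w n \<in> C n" "w \<longlonglongrightarrow> z"
    by (auto simp: LimInn_def)
  from assms w(1) have "\<forall>\<^sub>F n in sequentially. w n \<in> D n"
    by eventually_elim blast
  with w(2) show "z \<in> LimInn D" by (auto simp: LimInn_def)
qed

lemma null_sequences_dominated:
  fixes e :: "nat \<Rightarrow> nat \<Rightarrow> real"
  assumes nonneg: "\<And>k n. e k n \<ge> 0" and null: "\<And>k. e k \<longlonglongrightarrow> 0"
  obtains \<epsilon>s where "\<And>n. \<epsilon>s n \<ge> 0" "\<epsilon>s \<longlonglongrightarrow> 0" "\<And>k. \<forall>\<^sub>F n in sequentially. e k n \<le> \<epsilon>s n"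
proof
  define t where "t k n = min (e k n) (1 / Suc k)" for k n
  define \<epsilon>s where "\<epsilon>s n = (SUP k. t k n)" for n
  have t: "0 \<le> t k n" "t k n \<le> e k n" "t k n \<le> 1 / Suc k" for k n
    using nonneg by (auto simp: t_def)
  have bdd: "bdd_above (range (\<lambda>k. t k n))" for n
    by (rule bdd_aboveI2[of _ _ 1], rule order_trans[OF t(3)]) simp
  have le: "t k n \<le> \<epsilon>s n" for k n
    unfolding \<epsilon>s_def by (rule cSUP_upper[OF _ bdd]) simp
  show nn: "\<epsilon>s n \<ge> 0" for n
    using t(1) le by (rule order_trans)
  show "\<epsilon>s \<longlonglongrightarrow> 0"
  proof (rule order_tendstoI)
    fix a :: real assume "a < 0"
    then show "\<forall>\<^sub>F n in sequentially. a < \<epsilon>s n" by (intro always_eventually allI less_le_trans[OF _ nn])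
  next
    fix a :: real assume "a > 0"
    then obtain K where K: "1 / Suc K < a / 2"
      using reals_Archimedean[of "a / 2"] by (auto simp: inverse_eq_divide)
    have "\<forall>\<^sub>F n in sequentially. \<forall>k\<in>{..K}. e k n < a / 2"
      using \<open>a > 0\<close> by (intro eventually_ball_finite ballI order_tendstoD(2)[OF null]) auto
    then show "\<forall>\<^sub>F n in sequentially. \<epsilon>s n < a"
    proof eventually_elim
      case (elim n)
      have "\<epsilon>s n \<le> a / 2"
        unfolding \<epsilon>s_def
      proof (rule cSUP_least)
        fix k
        show "t k n \<le> a / 2"
        proof (cases "k \<le> K")
          case True
          then have "e k n < a / 2" using elim by simp
          with t(2)[of k n] show ?thesis by linarith
        next
          case False
          then have "1 / Suc k \<le> 1 / Suc K" by (intro divide_left_mono) auto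
          with t(3)[of k n] K show ?thesis by linarith
        qed
      qed simp
      with \<open>a > 0\<close> show ?case by simp
    qed
  qed
  show "\<forall>\<^sub>F n in sequentially. e k n \<le> \<epsilon>s n" for k
  proof -
    have "\<forall>\<^sub>F n in sequentially. e k n < 1 / Suc k"
      by (rule order_tendstoD(2)[OF null]) simp
    then show ?thesis
    proof eventually_elim
      case (elim n)
      then have "t k n = e k n" by (simp add: t_def)
      with le[of k n] show ?case by simp
    qed
  qed
qed

lemma eps_argmin_0: "eps_argmin 0 f = argmin f"
proof -
  have "(INF w. f w) \<le> f z" for z by (rule INF_lower) simp
  then show ?thesis by (auto simp: eps_argmin_def argmin_def order_eq_iff[of "f _"])
qed

lemma eps_argmin_mono:
  assumes "\<epsilon> \<le> \<delta>" shows "eps_argmin \<epsilon> f \<subseteq> eps_argmin \<delta> f"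
proof -
  have "(INF w. f w) + ereal \<epsilon> \<le> (INF w. f w) + ereal \<delta>"
    using assms by (intro add_left_mono) simp
  then show ?thesis unfolding eps_argmin_def using order_trans by blast
qed

text \<open>The tolerances found for a countable dense set of minimisers are merged into a single null
  sequence; all other minimisers are reached because inner limits are closed.\<close>

lemma epi_argmin_Lim:
  fixes f :: "'a::{metric_space, second_countable_topology} \<Rightarrow> ereal"
  assumes epi: "epi_converges fs f" and m: "(INF z. f z) = ereal m"
    and lim: "(\<lambda>n. INF z. fs n z) \<longlonglongrightarrow> (INF z. f z)" and ne: "argmin f \<noteq> {}"
  obtains \<epsilon>s where "\<And>n. \<epsilon>s n \<ge> 0" "\<epsilon>s \<longlonglongrightarrow> 0"
    "Lim_eq (\<lambda>n. eps_argmin (\<epsilon>s n) (fs n)) (argmin f)"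
proof -
  obtain T where T: "countable T" "T \<subseteq> argmin f" "argmin f \<subseteq> closure T"
    using separable by blast
  have "T \<noteq> {}" using T(3) ne by auto
  with T(1) obtain p :: "nat \<Rightarrow> 'a" where p: "range p = T"
    using uncountable_def[of T] by blast
  have "\<exists>e. (\<forall>n. e n \<ge> 0) \<and> e \<longlonglongrightarrow> 0 \<and>
      p k \<in> LimInn (\<lambda>n. eps_argmin (e n) (fs n))" for k
  proof -
    have "p k \<in> argmin f" using p T(2) by auto
    from epi m lim this show ?thesis by (rule epi_argmin_LimInn) (intro exI conjI allI)
  qed
  then obtain e where e: "\<And>k. (\<forall>n. e k n \<ge> 0) \<and> e k \<longlonglongrightarrow> 0 \<and>
      p k \<in> LimInn (\<lambda>n. eps_argmin (e k n) (fs n))"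
    using choice[of "\<lambda>k e. (\<forall>n. e n \<ge> 0) \<and> e \<longlonglongrightarrow> 0 \<and>
      p k \<in> LimInn (\<lambda>n. eps_argmin (e n) (fs n))"] by auto
  have e1: "e k n \<ge> 0" and e2: "e k \<longlonglongrightarrow> 0" for k n
    using e by auto
  obtain \<epsilon>s where \<epsilon>s: "\<And>n. \<epsilon>s n \<ge> 0" "\<epsilon>s \<longlonglongrightarrow> 0" "\<And>k. \<forall>\<^sub>F n in sequentially. e k n \<le> \<epsilon>s n"
    using null_sequences_dominated[of e, OF e1 e2] by blast
  let ?C = "\<lambda>n. eps_argmin (\<epsilon>s n) (fs n)"
  have "p k \<in> LimInn ?C" for k
  proof -
    have "\<forall>\<^sub>F n in sequentially. eps_argmin (e k n) (fs n) \<subseteq> ?C n"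
      using \<epsilon>s(3)[of k] by (rule eventually_mono) (rule eps_argmin_mono)
    from LimInn_mono[OF this] e[of k] show ?thesis by blast
  qed
  then have "T \<subseteq> LimInn ?C"
    unfolding p[symmetric] by (rule image_subsetI)
  then have "argmin f \<subseteq> LimInn ?C"
    using T(3) closure_mono[of T "LimInn ?C"] LimInn_closure by (meson subset_iff)
  moreover have "LimOut ?C \<subseteq> argmin f"
    using epi_LimOut_eps_argmin[OF epi m \<epsilon>s(2)] by (simp add: eps_argmin_0)
  ultimately have "Lim_eq ?C (argmin f)"
    using LimInn_subset_LimOut[of ?C] by (auto simp: Lim_eq_def)
  with \<epsilon>s(1,2) show ?thesis by (rule that)
qed

section \<open>Lower semicontinuity\<close>

lemma lsc_onD:
  assumes "lsc_on S \<psi>" "z \<in> S" "c < \<psi> z"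
  obtains U where "open U" "z \<in> U" "\<And>y. y \<in> U \<Longrightarrow> y \<in> S \<Longrightarrow> c < \<psi> y"
proof -
  have "\<psi> z \<le> Liminf (at z within S) \<psi>"
    using assms(1,2) by (simp add: lsc_on_def)
  with assms(3) have "c < Liminf (at z within S) \<psi>" by (rule less_le_trans)
  then have "\<forall>\<^sub>F y in at z within S. c < \<psi> y" by (rule less_LiminfD)
  then obtain U where U: "open U" "z \<in> U" "\<And>y. y \<in> U \<Longrightarrow> y \<noteq> z \<Longrightarrow> y \<in> S \<Longrightarrow> c < \<psi> y"
    unfolding eventually_at_topological by blast
  have "c < \<psi> y" if "y \<in> U" "y \<in> S" for y
    using U(3)[OF _ _ that(2)] that(1) assms(3) by (cases "y = z") auto
  with U(1,2) show ?thesis by (rule that)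
qed

lemma lsc_on_eventually:
  assumes "lsc_on S \<psi>" "z \<in> S" "c < \<psi> z" "w \<longlonglongrightarrow> z" "\<And>n. w n \<in> S"
  shows "\<forall>\<^sub>F n in sequentially. c < \<psi> (w n)"
proof -
  obtain U where U: "open U" "z \<in> U" "\<And>y. y \<in> U \<Longrightarrow> y \<in> S \<Longrightarrow> c < \<psi> y"
    using lsc_onD[OF assms(1-3)] by blast
  have "\<forall>\<^sub>F n in sequentially. w n \<in> U"
    using assms(4) U(1,2) by (rule topological_tendstoD)
  then show ?thesis by eventually_elim (use U(3) assms(5) in blast)
qed

lemma lsc_on_UNIV_liminf:
  assumes "lsc_on UNIV \<psi>" "w \<longlonglongrightarrow> z"
  shows "\<psi> z \<le> liminf (\<lambda>n. \<psi> (w n))"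
  unfolding le_Liminf_iff using lsc_on_eventually[OF assms(1) _ _ assms(2)] by simp

lemma lsc_on_section:
  fixes g :: "'a::topological_space \<Rightarrow> 'b::topological_space \<Rightarrow> real"
  assumes "lsc_on (S \<times> UNIV) (\<lambda>(\<xi>, x). ereal (g \<xi> x))"
    and "\<xi> \<in> S" "c < g \<xi> x"
  obtains U where "open U" "\<xi> \<in> U" "\<And>\<zeta>. \<zeta> \<in> U \<Longrightarrow> \<zeta> \<in> S \<Longrightarrow> c < g \<zeta> x"
proof -
  let ?g = "\<lambda>(\<xi>, x). ereal (g \<xi> x)"
  have "(\<xi>, x) \<in> S \<times> UNIV" "ereal c < ?g (\<xi>, x)" using assms(2,3) by auto
  with assms(1) obtain U where U: "open U" "(\<xi>, x) \<in> U"
    and gt: "\<And>y. y \<in> U \<Longrightarrow> y \<in> S \<times> UNIV \<Longrightarrow> ereal c < ?g y"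
    by (rule lsc_onD) blast
  obtain A B where A: "open A" "open B" "(\<xi>, x) \<in> A \<times> B" "A \<times> B \<subseteq> U"
    using U by (rule open_prod_elim)
  have "c < g \<zeta> x" if "\<zeta> \<in> A" "\<zeta> \<in> S" for \<zeta>
    using gt[of "(\<zeta>, x)"] that A(3,4) by auto
  then show ?thesis using A(1,3) that[of A] by blast
qed

lemma lsc_on_section_measurable:
  fixes g :: "'a::topological_space \<Rightarrow> 'b::topological_space \<Rightarrow> real"
  assumes "lsc_on (S \<times> UNIV) (\<lambda>(\<xi>, x). ereal (g \<xi> x))"
  shows "(\<lambda>\<xi>. g \<xi> x) \<in> borel_measurable (restrict_space borel S)"
proof (rule borel_measurable_iff_greater[THEN iffD2, rule_format])
  fix c :: real
  define V where "V = \<Union>{U. open U \<and> (\<forall>\<zeta>\<in>U \<inter> S. c < g \<zeta> x)}"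
  have "{\<xi> \<in> S. c < g \<xi> x} = V \<inter> S"
  proof (intro equalityI subsetI)
    fix \<xi> assume "\<xi> \<in> {\<xi> \<in> S. c < g \<xi> x}"
    then have \<xi>: "\<xi> \<in> S" "c < g \<xi> x" by auto
    obtain U where "open U" "\<xi> \<in> U" "\<And>\<zeta>. \<zeta> \<in> U \<Longrightarrow> \<zeta> \<in> S \<Longrightarrow> c < g \<zeta> x"
      using lsc_on_section[OF assms \<xi>] by metis
    with \<xi>(1) show "\<xi> \<in> V \<inter> S" by (auto simp: V_def)
  qed (auto simp: V_def)
  moreover have "open V" unfolding V_def by auto
  ultimately have "{\<xi> \<in> S. c < g \<xi> x} \<in> sets (restrict_space borel S)"
    unfolding sets_restrict_space by (intro image_eqI[of _ _ V]) auto
  then show "{\<xi> \<in> space (restrict_space borel S). c < g \<xi> x} \<in> sets (restrict_space borel S)"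
    by (simp add: space_restrict_space)
qed

section \<open>Inf-convolutions with powers of the norm\<close>

lemma powr_diff_le:
  fixes a b p :: real
  assumes "a \<ge> 0" "b \<ge> 0" "p \<ge> 1"
  shows "a powr p - b powr p \<le> p * (max a b powr (p - 1) * \<bar>a - b\<bar>)"
proof (cases "b < a")
  case False
  then have "a powr p \<le> b powr p" using assms by (intro powr_mono2) auto
  moreover have "0 \<le> p * (max a b powr (p - 1) * \<bar>a - b\<bar>)" using assms by simp
  ultimately show ?thesis by linarith
next
  case True
  show ?thesis
  proof (cases "b = 0")
    case True
    have "a powr p = a powr (p - 1) * a"
      using assms \<open>b < a\<close> by (simp add: powr_diff)
    also have "\<dots> \<le> p * (a powr (p - 1) * a)"
      using assms mult_right_mono[of 1 p "a powr (p - 1) * a"] by simp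
    finally show ?thesis using True \<open>b < a\<close> assms by (simp add: max_def)
  next
    case False
    have "((\<lambda>x. x powr p) has_real_derivative p * x powr (p - 1)) (at x)" if "b \<le> x" "x \<le> a" for x
      using that assms False by (auto intro!: derivative_eq_intros)
    from MVT2[OF \<open>b < a\<close> this] obtain c where c: "b < c" "c < a"
      "a powr p - b powr p = (a - b) * (p * c powr (p - 1))" by auto
    have "c powr (p - 1) \<le> a powr (p - 1)" using c assms by (intro powr_mono2) auto
    then have "(a - b) * (p * c powr (p - 1)) \<le> (a - b) * (p * a powr (p - 1))"
      using \<open>b < a\<close> assms by (intro mult_left_mono) auto
    with c(3) \<open>b < a\<close> show ?thesis by (simp add: max_def mult_ac)
  qed
qed

definition envelope :: "real \<Rightarrow> 'a::real_normed_vector set \<Rightarrow> real \<Rightarrow> ('a \<Rightarrow> real) \<Rightarrow> 'a \<Rightarrow> real" where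
  "envelope \<beta> \<Xi> t q \<xi> = (INF \<zeta>\<in>\<Xi>. q \<zeta> + 1 / (\<beta> * t) * norm (\<zeta> - \<xi>) powr \<beta>)"

locale bounded_envelope =
  fixes \<beta> t M :: real and \<Xi> :: "'a::euclidean_space set" and q :: "'a \<Rightarrow> real"
  assumes \<beta>: "\<beta> \<ge> 1" and t: "t > 0" and ne: "\<Xi> \<noteq> {}" and M: "\<And>\<zeta>. \<zeta> \<in> \<Xi> \<Longrightarrow> \<bar>q \<zeta>\<bar> \<le> M"
begin

lemma lower_term:
  assumes "\<zeta> \<in> \<Xi>" shows "-M \<le> q \<zeta> + 1 / (\<beta> * t) * norm (\<zeta> - \<xi>) powr \<beta>"
proof -
  have "0 \<le> 1 / (\<beta> * t) * norm (\<zeta> - \<xi>) powr \<beta>" using \<beta> t by simp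
  with M[OF assms] show ?thesis by linarith
qed

lemma bdd_below_terms: "bdd_below ((\<lambda>\<zeta>. q \<zeta> + 1 / (\<beta> * t) * norm (\<zeta> - \<xi>) powr \<beta>) ` \<Xi>)"
  by (rule bdd_belowI2[OF lower_term])

lemma envelope_le: "\<zeta> \<in> \<Xi> \<Longrightarrow> envelope \<beta> \<Xi> t q \<xi> \<le> q \<zeta> + 1 / (\<beta> * t) * norm (\<zeta> - \<xi>) powr \<beta>"
  unfolding envelope_def by (rule cINF_lower[OF bdd_below_terms])

lemma envelope_le_self: "\<xi> \<in> \<Xi> \<Longrightarrow> envelope \<beta> \<Xi> t q \<xi> \<le> q \<xi>"
  using envelope_le[of \<xi> \<xi>] by simp

lemma envelope_ge: "-M \<le> envelope \<beta> \<Xi> t q \<xi>"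
  unfolding envelope_def by (rule cINF_greatest[OF ne lower_term])

lemma near_minimiser:
  assumes \<xi>: "\<xi> \<in> \<Xi>" and e: "0 < e" "e \<le> 1"
  obtains \<zeta> where "\<zeta> \<in> \<Xi>" "q \<zeta> + 1 / (\<beta> * t) * norm (\<zeta> - \<xi>) powr \<beta> < envelope \<beta> \<Xi> t q \<xi> + e"
    "norm (\<zeta> - \<xi>) powr \<beta> \<le> \<beta> * t * (2 * M + 1)"
proof -
  have "(INF \<zeta>\<in>\<Xi>. q \<zeta> + 1 / (\<beta> * t) * norm (\<zeta> - \<xi>) powr \<beta>) < envelope \<beta> \<Xi> t q \<xi> + e"
    using e by (simp add: envelope_def)
  then obtain \<zeta> where \<zeta>: "\<zeta> \<in> \<Xi>"
    "q \<zeta> + 1 / (\<beta> * t) * norm (\<zeta> - \<xi>) powr \<beta> < envelope \<beta> \<Xi> t q \<xi> + e"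
    unfolding cINF_less_iff[OF ne bdd_below_terms] by blast
  have "1 / (\<beta> * t) * norm (\<zeta> - \<xi>) powr \<beta> \<le> 2 * M + 1"
    using \<zeta>(2) envelope_le_self[OF \<xi>] M[OF \<xi>] M[OF \<zeta>(1)] e by linarith
  then have "norm (\<zeta> - \<xi>) powr \<beta> \<le> \<beta> * t * (2 * M + 1)"
    using \<beta> t by (simp add: field_simps)
  with \<zeta> show ?thesis by (rule that)
qed

lemma envelope_lipschitz:
  assumes D: "\<beta> * t * (2 * M + 1) \<le> D" "1 \<le> D" and \<xi>: "\<xi>1 \<in> \<Xi>" "\<xi>2 \<in> \<Xi>"
  shows "envelope \<beta> \<Xi> t q \<xi>1 - envelope \<beta> \<Xi> t q \<xi>2 \<le>
    (D + 2) powr (\<beta> - 1) / t * (Max {1, norm \<xi>1, norm \<xi>2} powr (\<beta> - 1) * norm (\<xi>1 - \<xi>2))"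
    (is "?l \<le> ?r")
proof -
  define R where "R = Max {1, norm \<xi>1, norm \<xi>2}"
  have R: "1 \<le> R" "norm \<xi>1 \<le> R" "norm \<xi>2 \<le> R" by (auto simp: R_def)
  have *: "?l \<le> ?r + e" if e: "0 < e" "e \<le> 1" for e
  proof -
    obtain \<zeta> where \<zeta>: "\<zeta> \<in> \<Xi>"
      "q \<zeta> + 1 / (\<beta> * t) * norm (\<zeta> - \<xi>2) powr \<beta> < envelope \<beta> \<Xi> t q \<xi>2 + e"
      "norm (\<zeta> - \<xi>2) powr \<beta> \<le> \<beta> * t * (2 * M + 1)"
      using near_minimiser[OF \<xi>(2) e] .
    let ?a = "norm (\<zeta> - \<xi>1)" and ?b = "norm (\<zeta> - \<xi>2)"
    have b: "?b \<le> D"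
    proof (cases "?b \<le> 1")
      case False
      then have "?b powr 1 \<le> ?b powr \<beta>" using \<beta> by (intro powr_mono) auto
      with \<zeta>(3) D(1) False show ?thesis by simp
    qed (use D(2) in simp)
    have ab: "\<bar>?a - ?b\<bar> \<le> norm (\<xi>1 - \<xi>2)"
      using norm_triangle_ineq3[of "\<zeta> - \<xi>1" "\<zeta> - \<xi>2"] by (simp add: norm_minus_commute)
    have "norm (\<xi>1 - \<xi>2) \<le> 2 * R"
      using norm_triangle_ineq4[of \<xi>1 \<xi>2] R by linarith
    then have "max ?a ?b \<le> D + 2 * R" using ab b R by linarith
    also have "\<dots> \<le> (D + 2) * R"
      using D(2) R(1) by (simp add: distrib_right mult_le_cancel_left1)
    finally have "max ?a ?b powr (\<beta> - 1) \<le> ((D + 2) * R) powr (\<beta> - 1)"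
      using \<beta> by (intro powr_mono2) (auto simp: max_def)
    also have "\<dots> = (D + 2) powr (\<beta> - 1) * R powr (\<beta> - 1)"
      using D R by (simp add: powr_mult)
    finally have "max ?a ?b powr (\<beta> - 1) * \<bar>?a - ?b\<bar> \<le>
        ((D + 2) powr (\<beta> - 1) * R powr (\<beta> - 1)) * norm (\<xi>1 - \<xi>2)"
      using ab by (intro mult_mono) auto
    then have "1 / (\<beta> * t) * (\<beta> * (max ?a ?b powr (\<beta> - 1) * \<bar>?a - ?b\<bar>)) \<le>
        1 / (\<beta> * t) * (\<beta> * (((D + 2) powr (\<beta> - 1) * R powr (\<beta> - 1)) * norm (\<xi>1 - \<xi>2)))"
      using \<beta> t by (intro mult_left_mono) auto
    also have "\<dots> = ?r" using \<beta> by (simp add: R_def)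
    finally have "1 / (\<beta> * t) * (\<beta> * (max ?a ?b powr (\<beta> - 1) * \<bar>?a - ?b\<bar>)) \<le> ?r" .
    moreover have "1 / (\<beta> * t) * (?a powr \<beta> - ?b powr \<beta>) \<le>
        1 / (\<beta> * t) * (\<beta> * (max ?a ?b powr (\<beta> - 1) * \<bar>?a - ?b\<bar>))"
      using \<beta> t by (intro mult_left_mono powr_diff_le) auto
    ultimately have "1 / (\<beta> * t) * (?a powr \<beta> - ?b powr \<beta>) \<le> ?r" by linarith
    then show ?thesis
      using \<zeta>(2) envelope_le[OF \<zeta>(1), of \<xi>1] by (simp add: right_diff_distrib)
  qed
  show ?thesis
  proof (rule field_le_epsilon)
    fix e :: real assume "e > 0"
    then have "?l \<le> ?r + min e 1" by (intro *) auto
    then show "?l \<le> ?r + e" by linarith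
  qed
qed

lemma envelope_FM_class:
  assumes D: "\<beta> * t * (2 * M + 1) \<le> D" "1 \<le> D"
  shows "(\<lambda>\<xi>. t / (D + 2) powr (\<beta> - 1) * envelope \<beta> \<Xi> t q \<xi>) \<in> FM_class \<beta> \<Xi>"
  unfolding FM_class_def mem_Collect_eq
proof (intro ballI)
  fix \<xi>1 \<xi>2 assume \<xi>: "\<xi>1 \<in> \<Xi>" "\<xi>2 \<in> \<Xi>"
  let ?c = "t / (D + 2) powr (\<beta> - 1)" and ?E = "envelope \<beta> \<Xi> t q"
  let ?R = "Max {1, norm \<xi>1, norm \<xi>2} powr (\<beta> - 1) * norm (\<xi>1 - \<xi>2)"
  have c: "?c > 0" using D t by simp
  have "Max {1, norm \<xi>2, norm \<xi>1} = Max {1, norm \<xi>1, norm \<xi>2}"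
    by (simp add: insert_commute)
  then have "\<bar>?E \<xi>1 - ?E \<xi>2\<bar> \<le> (D + 2) powr (\<beta> - 1) / t * ?R"
    using envelope_lipschitz[OF D \<xi>] envelope_lipschitz[OF D \<xi>(2,1)] norm_minus_commute[of \<xi>1 \<xi>2]
    by (simp only: abs_le_iff minus_diff_eq)
  then have "?c * \<bar>?E \<xi>1 - ?E \<xi>2\<bar> \<le> ?c * ((D + 2) powr (\<beta> - 1) / t * ?R)"
    using c by (intro mult_left_mono) auto
  also have "\<dots> = ?R" using D t by simp
  also have "?c * \<bar>?E \<xi>1 - ?E \<xi>2\<bar> = \<bar>?c * ?E \<xi>1 - ?c * ?E \<xi>2\<bar>"
    unfolding right_diff_distrib[symmetric] abs_mult abs_of_pos[OF c] ..
  finally show "\<bar>?c * ?E \<xi>1 - ?c * ?E \<xi>2\<bar> \<le> ?R" .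
qed

lemma envelope_integrable:
  assumes "\<mu> \<in> prob_measures \<beta> \<Xi>"
  shows "integrable \<mu> (envelope \<beta> \<Xi> t q)"
proof -
  define D where "D = max 1 (\<beta> * t * (2 * M + 1))"
  have D: "\<beta> * t * (2 * M + 1) \<le> D" "1 \<le> D" by (auto simp: D_def)
  let ?c = "t / (D + 2) powr (\<beta> - 1)"
  have "integrable \<mu> (\<lambda>\<xi>. 1 / ?c * (?c * envelope \<beta> \<Xi> t q \<xi>))"
    by (intro integrable_mult_right FM_class_integrable[OF \<beta> assms envelope_FM_class[OF D]])
  moreover have "1 / ?c * (?c * envelope \<beta> \<Xi> t q \<xi>) = envelope \<beta> \<Xi> t q \<xi>" for \<xi>
    using D t by simp
  ultimately show ?thesis by simp
qed

lemma envelope_integral_diff: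
  assumes D: "\<beta> * t * (2 * M + 1) \<le> D" "1 \<le> D"
    and \<mu>: "\<mu>1 \<in> prob_measures \<beta> \<Xi>" "\<mu>2 \<in> prob_measures \<beta> \<Xi>"
  shows "\<bar>(\<integral>\<xi>. envelope \<beta> \<Xi> t q \<xi> \<partial>\<mu>1) - (\<integral>\<xi>. envelope \<beta> \<Xi> t q \<xi> \<partial>\<mu>2)\<bar>
    \<le> (D + 2) powr (\<beta> - 1) * (1 / t * d_FM \<beta> \<Xi> \<mu>1 \<mu>2)"
proof -
  let ?I = "\<lambda>\<mu>. \<integral>\<xi>. envelope \<beta> \<Xi> t q \<xi> \<partial>\<mu>" and ?c = "t / (D + 2) powr (\<beta> - 1)"
  have c: "?c > 0" using D t by simp
  have "\<bar>(\<integral>\<xi>. ?c * envelope \<beta> \<Xi> t q \<xi> \<partial>\<mu>1) - (\<integral>\<xi>. ?c * envelope \<beta> \<Xi> t q \<xi> \<partial>\<mu>2)\<bar>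
      \<le> d_FM \<beta> \<Xi> \<mu>1 \<mu>2"
    unfolding d_FM_def by (rule cSUP_upper[OF envelope_FM_class[OF D] bdd_above_FM[OF \<beta> \<mu>]])
  then have "?c * \<bar>?I \<mu>1 - ?I \<mu>2\<bar> \<le> d_FM \<beta> \<Xi> \<mu>1 \<mu>2"
    using c by (simp only: integral_mult_right_zero right_diff_distrib[symmetric] abs_mult abs_of_pos)
  then show ?thesis using c D t by (simp add: field_simps)
qed

end

lemma envelope_eventually_greater:
  fixes \<Xi> :: "'a::euclidean_space set" and x :: "'b::topological_space"
  assumes \<beta>: "\<beta> \<ge> 1" and \<xi>: "\<xi> \<in> \<Xi>" and M: "\<And>n. \<forall>\<zeta>\<in>\<Xi>. \<bar>g \<zeta> (xs n)\<bar> \<le> M"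
    and lsc: "lsc_on (\<Xi> \<times> UNIV) (\<lambda>(\<xi>, x). ereal (g \<xi> x))" and xs: "xs \<longlonglongrightarrow> x"
    and t: "\<And>n. t n > 0" "t \<longlonglongrightarrow> 0" and c: "c < g \<xi> x"
  shows "\<forall>\<^sub>F n in sequentially. c < envelope \<beta> \<Xi> (t n) (\<lambda>\<zeta>. g \<zeta> (xs n)) \<xi>"
proof -
  define e where "e = min 1 ((g \<xi> x - c) / 2)"
  have e: "0 < e" "e \<le> 1" "2 * e \<le> g \<xi> x - c" using c by (auto simp: e_def min_def field_simps)
  have env: "bounded_envelope \<beta> (t n) M \<Xi> (\<lambda>\<zeta>. g \<zeta> (xs n))" for n
    using \<beta> t(1) \<xi> M by unfold_locales auto
  have "\<exists>\<zeta>. \<zeta> \<in> \<Xi> \<and> g \<zeta> (xs n) + 1 / (\<beta> * t n) * norm (\<zeta> - \<xi>) powr \<beta> <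
      envelope \<beta> \<Xi> (t n) (\<lambda>\<zeta>. g \<zeta> (xs n)) \<xi> + e \<and>
      norm (\<zeta> - \<xi>) powr \<beta> \<le> \<beta> * t n * (2 * M + 1)" for n
    using bounded_envelope.near_minimiser[OF env \<xi> e(1,2)] by blast
  then obtain \<zeta> where \<zeta>: "\<And>n. \<zeta> n \<in> \<Xi>"
    "\<And>n. g (\<zeta> n) (xs n) + 1 / (\<beta> * t n) * norm (\<zeta> n - \<xi>) powr \<beta> <
      envelope \<beta> \<Xi> (t n) (\<lambda>\<zeta>. g \<zeta> (xs n)) \<xi> + e"
    "\<And>n. norm (\<zeta> n - \<xi>) powr \<beta> \<le> \<beta> * t n * (2 * M + 1)" by metis
  have "\<zeta> \<longlonglongrightarrow> \<xi>"
  proof (rule tendstoI)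
    fix d :: real assume d: "d > 0"
    have "(\<lambda>n. \<beta> * t n * (2 * M + 1)) \<longlonglongrightarrow> \<beta> * 0 * (2 * M + 1)"
      by (intro tendsto_intros t(2))
    then have "\<forall>\<^sub>F n in sequentially. \<beta> * t n * (2 * M + 1) < d powr \<beta>"
      using d by (intro order_tendstoD(2)) auto
    then show "\<forall>\<^sub>F n in sequentially. dist (\<zeta> n) \<xi> < d"
    proof eventually_elim
      case (elim n)
      show ?case
      proof (rule ccontr)
        assume "\<not> ?thesis"
        then have "d powr \<beta> \<le> norm (\<zeta> n - \<xi>) powr \<beta>"
          using d \<beta> by (intro powr_mono2) (auto simp: dist_norm)
        with elim \<zeta>(3)[of n] show False by linarith
      qed
    qed
  qed
  then have "(\<lambda>n. (\<zeta> n, xs n)) \<longlonglongrightarrow> (\<xi>, x)" using xs by (rule tendsto_Pair)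
  moreover have "ereal (g \<xi> x - e) < (\<lambda>(\<xi>, x). ereal (g \<xi> x)) (\<xi>, x)" using e by simp
  ultimately have "\<forall>\<^sub>F n in sequentially. ereal (g \<xi> x - e) < (\<lambda>(\<xi>, x). ereal (g \<xi> x)) (\<zeta> n, xs n)"
    using lsc_on_eventually[OF lsc] \<xi> \<zeta>(1) by blast
  then show ?thesis
  proof eventually_elim
    case (elim n)
    have "0 \<le> 1 / (\<beta> * t n) * norm (\<zeta> n - \<xi>) powr \<beta>" using \<beta> t(1)[of n] by simp
    with elim \<zeta>(2)[of n] e(3) show ?case by simp
  qed
qed

lemma prob_measures_space: "\<mu> \<in> prob_measures \<beta> \<Xi> \<Longrightarrow> space \<mu> = \<Xi>"
  using sets_eq_imp_space_eq[of \<mu> "restrict_space borel \<Xi>"]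
  by (simp add: prob_measures_def space_restrict_space)

lemma prob_measures_prob_space: "\<mu> \<in> prob_measures \<beta> \<Xi> \<Longrightarrow> prob_space \<mu>"
  by (simp add: prob_measures_def)

lemma lsc_section_integrable:
  fixes g :: "'a::euclidean_space \<Rightarrow> 'b::topological_space \<Rightarrow> real"
  assumes \<mu>: "\<mu> \<in> prob_measures \<beta> \<Xi>" and M: "\<forall>\<zeta>\<in>\<Xi>. \<bar>g \<zeta> x\<bar> \<le> M"
    and lsc: "lsc_on (\<Xi> \<times> UNIV) (\<lambda>(\<xi>, x). ereal (g \<xi> x))"
  shows "integrable \<mu> (\<lambda>\<xi>. g \<xi> x)"
proof -
  interpret prob_space \<mu> using \<mu> by (rule prob_measures_prob_space)
  have "sets \<mu> = sets (restrict_space borel \<Xi>)" using \<mu> by (simp add: prob_measures_def)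
  then have "(\<lambda>\<xi>. g \<xi> x) \<in> borel_measurable \<mu>"
    using lsc_on_section_measurable[OF lsc] measurable_cong_sets by blast
  then show ?thesis
    using M prob_measures_space[OF \<mu>] by (intro integrable_const_bound[of _ M]) auto
qed

lemma d_FM_nonneg:
  assumes "\<beta> \<ge> 1" "\<mu>1 \<in> prob_measures \<beta> \<Xi>" "\<mu>2 \<in> prob_measures \<beta> \<Xi>"
  shows "0 \<le> d_FM \<beta> \<Xi> \<mu>1 \<mu>2"
proof -
  have "(\<lambda>_. 0) \<in> FM_class \<beta> \<Xi>" by (simp add: FM_class_def)
  from cSUP_upper[OF this bdd_above_FM[OF assms]] show ?thesis by (simp add: d_FM_def)
qed

lemma bound_along_sequence:
  fixes q :: "'a \<Rightarrow> 'b::real_normed_vector \<Rightarrow> real"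
  assumes bdd: "\<And>x. \<exists>\<epsilon>>0. \<exists>M. \<forall>\<xi>\<in>\<Xi>. \<forall>y. norm (y - x) \<le> \<epsilon> \<longrightarrow> \<bar>q \<xi> y\<bar> \<le> M"
    and xs: "xs \<longlonglongrightarrow> x"
  obtains M where "\<forall>\<xi>\<in>\<Xi>. \<bar>q \<xi> x\<bar> \<le> M" "\<And>n. \<forall>\<xi>\<in>\<Xi>. \<bar>q \<xi> (xs n)\<bar> \<le> M"
proof -
  obtain \<epsilon> M0 where \<epsilon>: "\<epsilon> > 0" and M0: "\<And>\<xi> y. \<xi> \<in> \<Xi> \<Longrightarrow> norm (y - x) \<le> \<epsilon> \<Longrightarrow> \<bar>q \<xi> y\<bar> \<le> M0"
    using bdd[of x] by blast
  have "\<exists>M. \<forall>\<xi>\<in>\<Xi>. \<bar>q \<xi> y\<bar> \<le> M" for y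
  proof -
    obtain e M where "e > 0" "\<forall>\<xi>\<in>\<Xi>. \<forall>z. norm (z - y) \<le> e \<longrightarrow> \<bar>q \<xi> z\<bar> \<le> M"
      using bdd[of y] by blast
    then have "\<forall>\<xi>\<in>\<Xi>. \<bar>q \<xi> y\<bar> \<le> M" by auto
    then show ?thesis ..
  qed
  then obtain B where B: "\<And>y \<xi>. \<xi> \<in> \<Xi> \<Longrightarrow> \<bar>q \<xi> y\<bar> \<le> B y" by metis
  obtain n0 where n0: "\<And>n. n \<ge> n0 \<Longrightarrow> norm (xs n - x) < \<epsilon>"
    using LIMSEQ_D[OF xs \<epsilon>] by blast
  define M where "M = \<bar>M0\<bar> + (\<Sum>n<n0. \<bar>B (xs n)\<bar>)"
  have "\<bar>M0\<bar> \<le> M" by (simp add: M_def sum_nonneg)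
  then have near: "\<bar>q \<xi> y\<bar> \<le> M" if "\<xi> \<in> \<Xi>" "norm (y - x) \<le> \<epsilon>" for \<xi> y
    using M0[OF that] by linarith
  show ?thesis
  proof
    show "\<forall>\<xi>\<in>\<Xi>. \<bar>q \<xi> x\<bar> \<le> M"
      using near[of _ x] \<epsilon> by simp
    show "\<forall>\<xi>\<in>\<Xi>. \<bar>q \<xi> (xs n)\<bar> \<le> M" for n
    proof (cases "n < n0")
      case True
      then have "\<bar>B (xs n)\<bar> \<le> (\<Sum>n<n0. \<bar>B (xs n)\<bar>)"
        by (intro member_le_sum) auto
      then show ?thesis using B[of _ "xs n"] unfolding M_def by fastforce
    next
      case False
      then show ?thesis using n0[of n] by (auto intro!: near)
    qed
  qed
qed

lemma scaled_null_sequence_bounded: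
  fixes t :: "nat \<Rightarrow> real"
  assumes "t \<longlonglongrightarrow> 0"
  obtains D where "1 \<le> D" "\<And>n. \<beta> * t n * c \<le> D"
proof -
  have "(\<lambda>n. \<beta> * t n * c) \<longlonglongrightarrow> \<beta> * 0 * c" by (intro tendsto_intros assms)
  then have "Bseq (\<lambda>n. \<beta> * t n * c)" by (intro convergent_imp_Bseq convergentI)
  then obtain K where "\<And>n. \<bar>\<beta> * t n * c\<bar> \<le> K" unfolding Bseq_def real_norm_def by blast
  then have "\<beta> * t n * c \<le> max 1 K" for n
    using abs_ge_self[of "\<beta> * t n * c"] by (meson max.coboundedI2 order_trans)
  then show ?thesis by (intro that[of "max 1 K"]) auto
qed

text \<open>Truncating the envelopes from above by their pointwise limit turns the Fatou-type estimate
  into an application of dominated convergence.\<close>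

lemma envelope_expectation_lower:
  fixes \<Xi> :: "'a::euclidean_space set" and x :: "'b::topological_space"
  assumes \<beta>: "\<beta> \<ge> 1" and ne: "\<Xi> \<noteq> {}"
    and Mx: "\<forall>\<zeta>\<in>\<Xi>. \<bar>g \<zeta> x\<bar> \<le> M" and M: "\<And>n. \<forall>\<zeta>\<in>\<Xi>. \<bar>g \<zeta> (xs n)\<bar> \<le> M"
    and lsc: "lsc_on (\<Xi> \<times> UNIV) (\<lambda>(\<xi>, x). ereal (g \<xi> x))" and xs: "xs \<longlonglongrightarrow> x"
    and t: "\<And>n. t n > 0" "t \<longlonglongrightarrow> 0"
    and \<mu>: "\<mu> \<in> prob_measures \<beta> \<Xi>" "\<And>n. \<mu>s n \<in> prob_measures \<beta> \<Xi>"
    and d: "(\<lambda>n. 1 / t n * d_FM \<beta> \<Xi> (\<mu>s n) \<mu>) \<longlonglongrightarrow> 0"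
  obtains v where "v \<longlonglongrightarrow> (\<integral>\<xi>. g \<xi> x \<partial>\<mu>)"
    "\<And>n. v n \<le> (\<integral>\<xi>. envelope \<beta> \<Xi> (t n) (\<lambda>\<zeta>. g \<zeta> (xs n)) \<xi> \<partial>\<mu>s n)"
proof -
  interpret prob_space \<mu> using \<mu>(1) by (rule prob_measures_prob_space)
  note sp = prob_measures_space[OF \<mu>(1)]
  let ?e = "\<lambda>n. envelope \<beta> \<Xi> (t n) (\<lambda>\<zeta>. g \<zeta> (xs n))"
  have env: "bounded_envelope \<beta> (t n) M \<Xi> (\<lambda>\<zeta>. g \<zeta> (xs n))" for n
    using \<beta> t(1) ne M by unfold_locales auto
  obtain D where D: "1 \<le> D" "\<And>n. \<beta> * t n * (2 * M + 1) \<le> D"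
    using scaled_null_sequence_bounded[OF t(2)] by blast
  define k where "k n \<xi> = min (?e n \<xi>) (g \<xi> x)" for n \<xi>
  have int_e: "integrable \<mu> (?e n)" for n
    by (rule bounded_envelope.envelope_integrable[OF env \<mu>(1)])
  have int_g: "integrable \<mu> (\<lambda>\<xi>. g \<xi> x)"
    using \<mu>(1) Mx lsc by (rule lsc_section_integrable)
  have int_k: "integrable \<mu> (k n)" for n
    unfolding k_def using int_e int_g by (rule Bochner_Integration.integrable_min)
  have "(\<lambda>n. \<integral>\<xi>. k n \<xi> \<partial>\<mu>) \<longlonglongrightarrow> (\<integral>\<xi>. g \<xi> x \<partial>\<mu>)"
  proof (rule integral_dominated_convergence)
    show "AE \<xi> in \<mu>. (\<lambda>n. k n \<xi>) \<longlonglongrightarrow> g \<xi> x"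
    proof (rule AE_I2)
      fix \<xi> assume "\<xi> \<in> space \<mu>"
      then have \<xi>: "\<xi> \<in> \<Xi>" by (simp add: sp)
      show "(\<lambda>n. k n \<xi>) \<longlonglongrightarrow> g \<xi> x"
      proof (rule order_tendstoI)
        fix c assume "c < g \<xi> x"
        then have "\<forall>\<^sub>F n in sequentially. c < ?e n \<xi>"
          by (rule envelope_eventually_greater[where g = g and xs = xs and t = t, OF \<beta> \<xi> M lsc xs t])
        then show "\<forall>\<^sub>F n in sequentially. c < k n \<xi>"
          by eventually_elim (use \<open>c < g \<xi> x\<close> in \<open>simp add: k_def\<close>)
      next
        fix c assume "g \<xi> x < c"
        then show "\<forall>\<^sub>F n in sequentially. k n \<xi> < c"
          by (intro always_eventually allI) (simp add: k_def min_less_iff_disj)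
      qed
    qed
    show "AE \<xi> in \<mu>. norm (k n \<xi>) \<le> M" for n
    proof (rule AE_I2)
      fix \<xi> assume "\<xi> \<in> space \<mu>"
      then have \<xi>: "\<xi> \<in> \<Xi>" by (simp add: sp)
      show "norm (k n \<xi>) \<le> M"
        using bounded_envelope.envelope_ge[OF env, of n \<xi>] bspec[OF Mx \<xi>]
        unfolding k_def real_norm_def by linarith
    qed
  qed (use int_g int_k in auto)
  then have "(\<lambda>n. (\<integral>\<xi>. k n \<xi> \<partial>\<mu>) - (D + 2) powr (\<beta> - 1) * (1 / t n * d_FM \<beta> \<Xi> (\<mu>s n) \<mu>))
      \<longlonglongrightarrow> (\<integral>\<xi>. g \<xi> x \<partial>\<mu>) - (D + 2) powr (\<beta> - 1) * 0"
    by (intro tendsto_diff tendsto_mult tendsto_const d)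
  moreover have "(\<integral>\<xi>. k n \<xi> \<partial>\<mu>) - (D + 2) powr (\<beta> - 1) * (1 / t n * d_FM \<beta> \<Xi> (\<mu>s n) \<mu>)
      \<le> (\<integral>\<xi>. ?e n \<xi> \<partial>\<mu>s n)" for n
  proof -
    have "(\<integral>\<xi>. k n \<xi> \<partial>\<mu>) \<le> (\<integral>\<xi>. ?e n \<xi> \<partial>\<mu>)"
      using int_k int_e by (rule integral_mono) (simp add: k_def)
    then show ?thesis
      using bounded_envelope.envelope_integral_diff[OF env D(2) D(1) \<mu>(2) \<mu>(1), of n n] by linarith
  qed
  ultimately show ?thesis by (intro that) auto
qed

lemma envelope_expectation_upper:
  fixes \<Xi> :: "'a::euclidean_space set" and x :: "'b::topological_space"
  assumes \<beta>: "\<beta> \<ge> 1" and ne: "\<Xi> \<noteq> {}"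
    and M: "\<forall>\<zeta>\<in>\<Xi>. \<bar>g \<zeta> x\<bar> \<le> M"
    and lsc: "lsc_on (\<Xi> \<times> UNIV) (\<lambda>(\<xi>, x). ereal (g \<xi> x))"
    and t: "\<And>n. t n > 0" "t \<longlonglongrightarrow> 0"
    and \<mu>: "\<mu> \<in> prob_measures \<beta> \<Xi>" "\<And>n. \<mu>s n \<in> prob_measures \<beta> \<Xi>"
  obtains C where "\<And>n. (\<integral>\<xi>. envelope \<beta> \<Xi> (t n) (\<lambda>\<zeta>. g \<zeta> x) \<xi> \<partial>\<mu>s n) \<le>
      (\<integral>\<xi>. g \<xi> x \<partial>\<mu>) + C * (1 / t n * d_FM \<beta> \<Xi> (\<mu>s n) \<mu>)"
proof -
  let ?e = "\<lambda>n. envelope \<beta> \<Xi> (t n) (\<lambda>\<zeta>. g \<zeta> x)"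
  have env: "bounded_envelope \<beta> (t n) M \<Xi> (\<lambda>\<zeta>. g \<zeta> x)" for n
    using \<beta> t(1) ne M by unfold_locales auto
  obtain D where D: "1 \<le> D" "\<And>n. \<beta> * t n * (2 * M + 1) \<le> D"
    using scaled_null_sequence_bounded[OF t(2)] by blast
  have "(\<integral>\<xi>. ?e n \<xi> \<partial>\<mu>s n) \<le>
      (\<integral>\<xi>. g \<xi> x \<partial>\<mu>) + (D + 2) powr (\<beta> - 1) * (1 / t n * d_FM \<beta> \<Xi> (\<mu>s n) \<mu>)" for n
  proof -
    have "(\<integral>\<xi>. ?e n \<xi> \<partial>\<mu>) \<le> (\<integral>\<xi>. g \<xi> x \<partial>\<mu>)"
      using bounded_envelope.envelope_integrable[OF env \<mu>(1)] lsc_section_integrable[OF \<mu>(1) M lsc]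
      by (rule integral_mono)
        (simp_all add: prob_measures_space[OF \<mu>(1)] bounded_envelope.envelope_le_self[OF env])
    then show ?thesis
      using bounded_envelope.envelope_integral_diff[OF env D(2) D(1) \<mu>(2) \<mu>(1), of n n] by linarith
  qed
  then show ?thesis by (rule that)
qed

lemma integral_vec_component:
  fixes q :: "'m::finite \<Rightarrow> 'a \<Rightarrow> real"
  assumes "\<And>i. integrable M (q i)"
  shows "(\<integral>\<xi>. (\<chi> i. q i \<xi>) \<partial>M) = (\<chi> i. \<integral>\<xi>. q i \<xi> \<partial>M)"
proof -
  have vec: "(\<chi> i. a i) = (\<Sum>i\<in>UNIV. a i *\<^sub>R axis i (1::real))" for a :: "'m \<Rightarrow> real"
    by (simp add: vec_eq_iff axis_def if_distrib[of "\<lambda>b. _ * b"] cong: if_cong)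
  show ?thesis
    unfolding vec using assms by (simp add: Bochner_Integration.integral_sum)
qed

lemma powr_null_imp_null:
  fixes r :: "nat \<Rightarrow> real"
  assumes "\<And>n. r n \<ge> 0" "a > 0" "(\<lambda>n. r n powr a) \<longlonglongrightarrow> 0"
  shows "r \<longlonglongrightarrow> 0"
proof (rule tendstoI)
  fix e :: real assume e: "e > 0"
  then have "\<forall>\<^sub>F n in sequentially. r n powr a < e powr a"
    by (intro order_tendstoD(2)[OF assms(3)]) simp
  then show "\<forall>\<^sub>F n in sequentially. dist (r n) 0 < e"
  proof eventually_elim
    case (elim n)
    have "r n < e"
    proof (rule ccontr)
      assume "\<not> ?thesis"
      then have "e powr a \<le> r n powr a" using e assms(2) by (intro powr_mono2) auto
      with elim show False by simp
    qed
    then show ?case using assms(1)[of n] by simp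
  qed
qed

section \<open>Epi-convergence of the approximations\<close>

theorem proposition3p9:
  fixes \<Xi> :: "(real ^ 'd) set"
    and g0 :: "real ^ 'n \<Rightarrow> ereal"
    and h :: "real ^ 'm \<Rightarrow> ereal"
    and g :: "'m \<Rightarrow> real ^ 'd \<Rightarrow> real ^ 'n \<Rightarrow> real"
    and G :: "real ^ 'd \<Rightarrow> real ^ 'n \<Rightarrow> real ^ 'm"
    and Gs :: "nat \<Rightarrow> real ^ 'd \<Rightarrow> real ^ 'n \<Rightarrow> real ^ 'm"
    and \<mu> :: "(real ^ 'd) measure" and \<mu>s :: "nat \<Rightarrow> (real ^ 'd) measure"
    and \<alpha> \<beta> :: real and lam \<theta> :: "nat \<Rightarrow> real"
    and \<phi> :: "real ^ 'n \<Rightarrow> ereal"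
    and f :: "(real ^ 'm) \<times> (real ^ 'n) \<Rightarrow> ereal"
    and fs :: "nat \<Rightarrow> (real ^ 'm) \<times> (real ^ 'n) \<Rightarrow> ereal"
  assumes \<Xi>: "\<Xi> \<noteq> {}" "closed \<Xi>"
    and \<beta>: "\<beta> \<ge> 1"
    and g0: "proper g0" "lsc_on UNIV g0"
    and h: "proper h" "lsc_on UNIV h" "mono h"
    and g_lsc: "\<And>i. lsc_on (\<Xi> \<times> UNIV) (\<lambda>(\<xi>, x). ereal (g i \<xi> x))"
    and g_bdd: "\<And>i x. \<exists>\<epsilon>>0. \<exists>M. \<forall>\<xi>\<in>\<Xi>. \<forall>y. norm (y - x) \<le> \<epsilon> \<longrightarrow> \<bar>g i \<xi> y\<bar> \<le> M"
    and G_def: "G = (\<lambda>\<xi> x. \<chi> i. g i \<xi> x)"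
    and Gs_def: "Gs = (\<lambda>\<nu> \<xi> x. \<chi> i. INF \<zeta>\<in>\<Xi>. g i \<zeta> x + 1 / (\<beta> * \<theta> \<nu>) * norm (\<zeta> - \<xi>) powr \<beta>)"
    and \<mu>: "\<mu> \<in> prob_measures \<beta> \<Xi>" "\<And>\<nu>. \<mu>s \<nu> \<in> prob_measures \<beta> \<Xi>"
    and d_tendsto: "(\<lambda>\<nu>. d_FM \<beta> \<Xi> (\<mu>s \<nu>) \<mu>) \<longlonglongrightarrow> 0"
    and \<alpha>: "\<alpha> \<ge> 1"
    and lam: "\<And>\<nu>. lam \<nu> > 0" "lam \<longlonglongrightarrow> 0"
    and \<theta>: "\<And>\<nu>. \<theta> \<nu> > 0" "\<theta> \<longlonglongrightarrow> 0"
    and rate: "(\<lambda>\<nu>. 1 / lam \<nu> * (1 / \<theta> \<nu> * d_FM \<beta> \<Xi> (\<mu>s \<nu>) \<mu>) powr \<alpha>) \<longlonglongrightarrow> 0"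
    and \<phi>_def: "\<phi> = (\<lambda>x. g0 x + h (\<integral>\<xi>. G \<xi> x \<partial>\<mu>))"
    and f_def: "f = (\<lambda>(u, x). g0 x + h (u + (\<integral>\<xi>. G \<xi> x \<partial>\<mu>)) + iota {0} u)"
    and fs_def: "fs = (\<lambda>\<nu> (u, x). g0 x + h (u + (\<integral>\<xi>. Gs \<nu> \<xi> x \<partial>(\<mu>s \<nu>)))
                        + ereal (1 / (\<alpha> * lam \<nu>) * norm u powr \<alpha>))"
    and argmin_nonempty: "argmin \<phi> \<noteq> {}"
  shows "epi_converges fs f
    \<and> \<comment> \<open>(a)\<close>
      ((INF z. f z) = (INF x. \<phi> x) \<and>
       (\<forall>\<epsilon>\<ge>0. eps_argmin \<epsilon> f = {0} \<times> eps_argmin \<epsilon> \<phi>))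
    \<and> \<comment> \<open>(b)\<close>
      limsup (\<lambda>\<nu>. INF z. fs \<nu> z) \<le> (INF z. f z)
    \<and> \<comment> \<open>(c)\<close>
      (\<forall>\<epsilon>s \<epsilon>. (\<forall>\<nu>. \<epsilon>s \<nu> \<ge> 0) \<and> \<epsilon> \<ge> 0 \<and> \<epsilon>s \<longlonglongrightarrow> \<epsilon> \<longrightarrow>
         LimOut (\<lambda>\<nu>. eps_argmin (\<epsilon>s \<nu>) (fs \<nu>)) \<subseteq> eps_argmin \<epsilon> f)
    \<and> \<comment> \<open>(d)\<close>
      (\<forall>\<epsilon>s N w. (\<forall>\<nu>. \<epsilon>s \<nu> \<ge> 0) \<and> \<epsilon>s \<longlonglongrightarrow> 0 \<and> infinite N \<and>
         (\<forall>\<nu>\<in>N. w \<nu> \<in> eps_argmin (\<epsilon>s \<nu>) (fs \<nu>)) \<and> (\<exists>z. (w \<longlongrightarrow> z) (along N)) \<longrightarrow>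
         ((\<lambda>\<nu>. INF z. fs \<nu> z) \<longlongrightarrow> (INF z. f z)) (along N))
    \<and> \<comment> \<open>(e)\<close>
      ((\<lambda>\<nu>. INF z. fs \<nu> z) \<longlonglongrightarrow> (INF z. f z) \<longleftrightarrow> tight_funs fs)
    \<and> \<comment> \<open>(f)\<close>
      ((\<lambda>\<nu>. INF z. fs \<nu> z) \<longlonglongrightarrow> (INF z. f z) \<longrightarrow>
         (\<forall>x0\<in>argmin \<phi>. \<exists>\<epsilon>s. (\<forall>\<nu>. \<epsilon>s \<nu> \<ge> 0) \<and> \<epsilon>s \<longlonglongrightarrow> 0 \<and>
            (0, x0) \<in> LimInn (\<lambda>\<nu>. eps_argmin (\<epsilon>s \<nu>) (fs \<nu>))))
    \<and> \<comment> \<open>(g)\<close>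
      ((\<lambda>\<nu>. INF z. fs \<nu> z) \<longlonglongrightarrow> (INF z. f z) \<longrightarrow>
         (\<exists>\<epsilon>s. (\<forall>\<nu>. \<epsilon>s \<nu> \<ge> 0) \<and> \<epsilon>s \<longlonglongrightarrow> 0 \<and>
            Lim_eq (\<lambda>\<nu>. eps_argmin (\<epsilon>s \<nu>) (fs \<nu>)) (argmin f)))"
proof -
  let ?E = "\<lambda>x. \<integral>\<xi>. G \<xi> x \<partial>\<mu>" and ?Es = "\<lambda>\<nu> x. \<integral>\<xi>. Gs \<nu> \<xi> x \<partial>\<mu>s \<nu>"
  define \<rho> where "\<rho> \<nu> = 1 / \<theta> \<nu> * d_FM \<beta> \<Xi> (\<mu>s \<nu>) \<mu>" for \<nu>
  have \<rho>_nonneg: "\<rho> \<nu> \<ge> 0" for \<nu>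
    using d_FM_nonneg[OF \<beta> \<mu>(2) \<mu>(1)] \<theta>(1)[of \<nu>] by (simp add: \<rho>_def)
  have rate': "(\<lambda>\<nu>. 1 / lam \<nu> * \<rho> \<nu> powr \<alpha>) \<longlonglongrightarrow> 0"
    using rate by (simp add: \<rho>_def)
  have "(\<lambda>\<nu>. lam \<nu> * (1 / lam \<nu> * \<rho> \<nu> powr \<alpha>)) \<longlonglongrightarrow> 0 * 0"
    by (intro tendsto_mult lam(2) rate')
  moreover have "lam \<nu> * (1 / lam \<nu> * \<rho> \<nu> powr \<alpha>) = \<rho> \<nu> powr \<alpha>" for \<nu>
    using lam(1)[of \<nu>] by simp
  ultimately have \<rho>: "\<rho> \<longlonglongrightarrow> 0"
    using \<alpha> by (intro powr_null_imp_null[OF \<rho>_nonneg, of \<alpha>]) auto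
  have bdd: "\<exists>M. \<forall>\<xi>\<in>\<Xi>. \<bar>g i \<xi> x\<bar> \<le> M" for i x
  proof -
    obtain e M where "e > 0" "\<forall>\<xi>\<in>\<Xi>. \<forall>y. norm (y - x) \<le> e \<longrightarrow> \<bar>g i \<xi> y\<bar> \<le> M"
      using g_bdd[of x i] by blast
    then have "\<forall>\<xi>\<in>\<Xi>. \<bar>g i \<xi> x\<bar> \<le> M" by auto
    then show ?thesis ..
  qed

  have E: "?E x $ i = (\<integral>\<xi>. g i \<xi> x \<partial>\<mu>)" for x i
  proof -
    have "integrable \<mu> (\<lambda>\<xi>. g i \<xi> x)" for i
      using bdd[of i x] lsc_section_integrable[OF \<mu>(1) _ g_lsc] by blast
    from integral_vec_component[where q = "\<lambda>i \<xi>. g i \<xi> x", OF this] show ?thesis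
      by (simp add: G_def)
  qed
  have Es: "?Es \<nu> x $ i = (\<integral>\<xi>. envelope \<beta> \<Xi> (\<theta> \<nu>) (\<lambda>\<zeta>. g i \<zeta> x) \<xi> \<partial>\<mu>s \<nu>)" for \<nu> x i
  proof -
    have "integrable (\<mu>s \<nu>) (envelope \<beta> \<Xi> (\<theta> \<nu>) (\<lambda>\<zeta>. g i \<zeta> x))" for i
    proof -
      obtain M where "\<forall>\<xi>\<in>\<Xi>. \<bar>g i \<xi> x\<bar> \<le> M" using bdd by blast
      then have "bounded_envelope \<beta> (\<theta> \<nu>) M \<Xi> (\<lambda>\<zeta>. g i \<zeta> x)"
        using \<beta> \<theta>(1) \<Xi>(1) by unfold_locales auto
      then show ?thesis using \<mu>(2) by (rule bounded_envelope.envelope_integrable)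
    qed
    from integral_vec_component[where q = "\<lambda>i. envelope \<beta> \<Xi> (\<theta> \<nu>) (\<lambda>\<zeta>. g i \<zeta> x)", OF this]
    show ?thesis by (simp add: Gs_def envelope_def)
  qed

  have lower: "\<exists>v. v \<longlonglongrightarrow> ?E x \<and> (\<forall>\<nu>. v \<nu> \<le> ?Es \<nu> (xs \<nu>))" if xs: "xs \<longlonglongrightarrow> x" for xs x
  proof -
    have "\<exists>v. v \<longlonglongrightarrow> ?E x $ i \<and> (\<forall>\<nu>. v \<nu> \<le> ?Es \<nu> (xs \<nu>) $ i)" for i
    proof -
      obtain M where M: "\<forall>\<xi>\<in>\<Xi>. \<bar>g i \<xi> x\<bar> \<le> M" "\<And>n. \<forall>\<xi>\<in>\<Xi>. \<bar>g i \<xi> (xs n)\<bar> \<le> M"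
        by (rule bound_along_sequence[where q = "g i", OF g_bdd xs]) blast
      obtain v where "v \<longlonglongrightarrow> (\<integral>\<xi>. g i \<xi> x \<partial>\<mu>)"
        "\<And>\<nu>. v \<nu> \<le> (\<integral>\<xi>. envelope \<beta> \<Xi> (\<theta> \<nu>) (\<lambda>\<zeta>. g i \<zeta> (xs \<nu>)) \<xi> \<partial>\<mu>s \<nu>)"
        by (rule envelope_expectation_lower[where g = "g i" and xs = xs and \<mu>s = \<mu>s,
              OF \<beta> \<Xi>(1) M g_lsc xs \<theta> \<mu> \<rho>[unfolded \<rho>_def]]) blast
      then show ?thesis unfolding E Es by blast
    qed
    then obtain v where v: "\<And>i. v i \<longlonglongrightarrow> ?E x $ i" "\<And>i \<nu>. v i \<nu> \<le> ?Es \<nu> (xs \<nu>) $ i"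
      by metis
    have "(\<lambda>\<nu>. \<chi> i. v i \<nu>) \<longlonglongrightarrow> ?E x" by (rule vec_tendstoI) (simp add: v(1))
    moreover have "(\<chi> i. v i \<nu>) \<le> ?Es \<nu> (xs \<nu>)" for \<nu> by (simp add: less_eq_vec_def v(2))
    ultimately show ?thesis by blast
  qed

  have upper: "\<exists>C\<ge>0. \<forall>\<nu> i. ?Es \<nu> x $ i \<le> ?E x $ i + C * \<rho> \<nu>" for x
  proof -
    have "\<exists>C. \<forall>\<nu>. ?Es \<nu> x $ i \<le> ?E x $ i + C * \<rho> \<nu>" for i
    proof -
      obtain M where M: "\<forall>\<xi>\<in>\<Xi>. \<bar>g i \<xi> x\<bar> \<le> M" using bdd by blast
      obtain C where "\<And>\<nu>. (\<integral>\<xi>. envelope \<beta> \<Xi> (\<theta> \<nu>) (\<lambda>\<zeta>. g i \<zeta> x) \<xi> \<partial>\<mu>s \<nu>) \<le>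
          (\<integral>\<xi>. g i \<xi> x \<partial>\<mu>) + C * \<rho> \<nu>"
        unfolding \<rho>_def
        by (rule envelope_expectation_upper[where g = "g i" and x = x and \<mu>s = \<mu>s, OF \<beta> \<Xi>(1) M g_lsc \<theta> \<mu>]) blast
      then show ?thesis unfolding E Es by blast
    qed
    then obtain C where C: "\<And>i \<nu>. ?Es \<nu> x $ i \<le> ?E x $ i + C i * \<rho> \<nu>" by metis
    have "C i * \<rho> \<nu> \<le> (\<Sum>i\<in>UNIV. \<bar>C i\<bar>) * \<rho> \<nu>" for i \<nu>
      using member_le_sum[of i UNIV "\<lambda>i. \<bar>C i\<bar>"]
      by (intro mult_right_mono \<rho>_nonneg) (auto intro: order_trans[OF abs_ge_self])
    with C have "?Es \<nu> x $ i \<le> ?E x $ i + (\<Sum>i\<in>UNIV. \<bar>C i\<bar>) * \<rho> \<nu>" for i \<nu>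
      by (meson add_left_mono order_trans)
    then show ?thesis by (intro exI[of _ "\<Sum>i\<in>UNIV. \<bar>C i\<bar>"]) (simp add: sum_nonneg)
  qed

  have g0_fin: "g0 x \<noteq> -\<infinity>" and h_fin: "h y \<noteq> -\<infinity>" for x y
    using g0(1) h(1) by (auto simp: proper_def)
  have f_0: "f (0, x) = \<phi> x" and f_neq: "u \<noteq> 0 \<Longrightarrow> f (u, x) = \<infinity>" for u x
    by (simp_all add: f_def \<phi>_def iota_def)

  have epi: "epi_converges fs f"
    unfolding epi_converges_def
  proof (intro allI conjI impI)
    fix z :: "(real ^ 'm) \<times> (real ^ 'n)" and w
    obtain u x where z: "z = (u, x)" by (cases z)
    assume w: "w \<longlonglongrightarrow> z"
    define us xs where "us \<nu> = fst (w \<nu>)" and "xs \<nu> = snd (w \<nu>)" for \<nu>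
    have us: "us \<longlonglongrightarrow> u" and xs: "xs \<longlonglongrightarrow> x"
      using tendsto_fst[OF w] tendsto_snd[OF w] by (simp_all add: us_def[abs_def] xs_def[abs_def] z)
    obtain v where v: "v \<longlonglongrightarrow> ?E x" "\<And>\<nu>. v \<nu> \<le> ?Es \<nu> (xs \<nu>)"
      using lower[OF xs] by blast
    let ?A = "\<lambda>\<nu>. g0 (xs \<nu>)" and ?B = "\<lambda>\<nu>. h (us \<nu> + ?Es \<nu> (xs \<nu>))"
      and ?P = "\<lambda>\<nu>. ereal (1 / (\<alpha> * lam \<nu>) * norm (us \<nu>) powr \<alpha>)"
    have A: "g0 x \<le> liminf ?A" by (rule lsc_on_UNIV_liminf[OF g0(2) xs])
    have "h (u + ?E x) \<le> liminf (\<lambda>\<nu>. h (us \<nu> + v \<nu>))"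
      by (rule lsc_on_UNIV_liminf[OF h(2) tendsto_add[OF us v(1)]])
    also have "\<dots> \<le> liminf ?B"
      using v(2) by (intro Liminf_mono always_eventually allI monoD[OF h(3)] add_left_mono)
    finally have B: "h (u + ?E x) \<le> liminf ?B" .
    have P: "iota {0} u \<le> liminf ?P"
    proof (cases "u = 0")
      case True
      have "0 \<le> ?P \<nu>" for \<nu> using \<alpha> lam(1)[of \<nu>] by simp
      then have "0 \<le> liminf ?P" by (intro Liminf_bounded always_eventually allI)
      with True show ?thesis by (simp add: iota_def)
    next
      case False
      have "(\<lambda>\<nu>. norm (us \<nu>) powr \<alpha>) \<longlonglongrightarrow> norm u powr \<alpha>"
        using False by (intro tendsto_intros us) auto
      moreover have "filterlim (\<lambda>\<nu>. 1 / (\<alpha> * lam \<nu>)) at_top sequentially"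
        unfolding inverse_eq_divide[symmetric]
      proof (rule filterlim_inverse_at_top)
        show "(\<lambda>\<nu>. \<alpha> * lam \<nu>) \<longlonglongrightarrow> 0" using tendsto_mult_right_zero[OF lam(2)] .
        show "\<forall>\<^sub>F \<nu> in sequentially. 0 < \<alpha> * lam \<nu>" using \<alpha> lam(1) by simp
      qed
      ultimately have "filterlim (\<lambda>\<nu>. norm (us \<nu>) powr \<alpha> * (1 / (\<alpha> * lam \<nu>))) at_top sequentially"
        using False by (intro filterlim_tendsto_pos_mult_at_top) auto
      then have "?P \<longlonglongrightarrow> \<infinity>" by (simp add: tendsto_PInfty_eq_at_top mult.commute)
      then have "liminf ?P = \<infinity>" by (intro lim_imp_Liminf) auto
      then show ?thesis by simp
    qed
    have Am: "liminf ?A \<noteq> -\<infinity>" and Bm: "liminf ?B \<noteq> -\<infinity>"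
      using A B g0_fin[of x] h_fin[of "u + ?E x"] by auto
    have Pm: "liminf ?P \<noteq> -\<infinity>" using P by (auto simp: iota_def split: if_splits)
    have AB: "liminf ?A + liminf ?B \<le> liminf (\<lambda>\<nu>. ?A \<nu> + ?B \<nu>)"
      using Am Bm by (intro ereal_liminf_add_mono) auto
    moreover have "liminf ?A + liminf ?B \<noteq> -\<infinity>" using Am Bm by simp
    ultimately have ABm: "liminf (\<lambda>\<nu>. ?A \<nu> + ?B \<nu>) \<noteq> -\<infinity>" by auto
    have "f z = g0 x + h (u + ?E x) + iota {0} u" by (simp add: f_def z)
    also have "\<dots> \<le> liminf ?A + liminf ?B + liminf ?P" by (intro add_mono A B P)
    also have "\<dots> \<le> liminf (\<lambda>\<nu>. ?A \<nu> + ?B \<nu>) + liminf ?P" by (intro add_right_mono AB)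
    also have "\<dots> \<le> liminf (\<lambda>\<nu>. ?A \<nu> + ?B \<nu> + ?P \<nu>)"
      using ABm Pm by (intro ereal_liminf_add_mono) auto
    also have "(\<lambda>\<nu>. ?A \<nu> + ?B \<nu> + ?P \<nu>) = (\<lambda>\<nu>. fs \<nu> (w \<nu>))"
      by (simp add: fs_def us_def xs_def case_prod_beta)
    finally show "f z \<le> liminf (\<lambda>\<nu>. fs \<nu> (w \<nu>))" .
  next
    fix z :: "(real ^ 'm) \<times> (real ^ 'n)"
    obtain u x where z: "z = (u, x)" by (cases z)
    show "\<exists>w. w \<longlonglongrightarrow> z \<and> limsup (\<lambda>\<nu>. fs \<nu> (w \<nu>)) \<le> f z"
    proof (cases "u = 0")
      case False
      then have "f z = \<infinity>" by (simp add: z f_neq)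
      then show ?thesis by (intro exI[of _ "\<lambda>_. z"]) simp
    next
      case True
      obtain C where C: "C \<ge> 0" "\<And>\<nu> i. ?Es \<nu> x $ i \<le> ?E x $ i + C * \<rho> \<nu>"
        using upper[of x] by blast
      define b :: "real ^ 'm" where "b = (\<chi> i. - C)"
      define w where "w \<nu> = (\<rho> \<nu> *\<^sub>R b, x)" for \<nu>
      have "w \<longlonglongrightarrow> (0 *\<^sub>R b, x)"
        unfolding w_def by (intro tendsto_intros \<rho>)
      then have "w \<longlonglongrightarrow> z" by (simp add: z True)
      moreover have "limsup (\<lambda>\<nu>. fs \<nu> (w \<nu>)) \<le> f z"
      proof -
        define p where "p \<nu> = norm b powr \<alpha> / \<alpha> * (1 / lam \<nu> * \<rho> \<nu> powr \<alpha>)" for \<nu>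
        have p: "1 / (\<alpha> * lam \<nu>) * norm (\<rho> \<nu> *\<^sub>R b) powr \<alpha> = p \<nu>" for \<nu>
          using \<rho>_nonneg[of \<nu>] by (simp add: p_def powr_mult)
        have "p \<longlonglongrightarrow> norm b powr \<alpha> / \<alpha> * 0"
          unfolding p_def by (intro tendsto_mult tendsto_const rate')
        then have "(\<lambda>\<nu>. ereal (p \<nu>)) \<longlonglongrightarrow> ereal 0" by simp
        then have "(\<lambda>\<nu>. f z + ereal (p \<nu>)) \<longlonglongrightarrow> f z + ereal 0"
          by (intro tendsto_add_ereal_general tendsto_const) auto
        then have lim: "limsup (\<lambda>\<nu>. f z + ereal (p \<nu>)) = f z"
          by (intro lim_imp_Limsup) auto
        have "fs \<nu> (w \<nu>) \<le> f z + ereal (p \<nu>)" for \<nu>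
        proof -
          have "\<rho> \<nu> *\<^sub>R b + ?Es \<nu> x \<le> ?E x"
            using C(2)[of \<nu>] by (simp add: less_eq_vec_def b_def algebra_simps)
          then have "h (\<rho> \<nu> *\<^sub>R b + ?Es \<nu> x) \<le> h (?E x)" by (rule monoD[OF h(3)])
          then have "g0 x + h (\<rho> \<nu> *\<^sub>R b + ?Es \<nu> x) + ereal (p \<nu>) \<le> g0 x + h (?E x) + ereal (p \<nu>)"
            by (intro add_mono order_refl)
          then show ?thesis
            unfolding w_def fs_def z True f_0 \<phi>_def by (simp only: prod.case p)
        qed
        then have "limsup (\<lambda>\<nu>. fs \<nu> (w \<nu>)) \<le> limsup (\<lambda>\<nu>. f z + ereal (p \<nu>))"
          by (intro Limsup_mono always_eventually allI)
        with lim show ?thesis by simp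
      qed
      ultimately show ?thesis by blast
    qed
  qed

  have inf_eq: "(INF z. f z) = (INF x. \<phi> x)"
  proof (rule antisym)
    show "(INF z. f z) \<le> (INF x. \<phi> x)"
      by (rule INF_greatest) (metis f_0 INF_lower UNIV_I)
    show "(INF x. \<phi> x) \<le> (INF z. f z)"
    proof (rule INF_greatest)
      fix z :: "(real ^ 'm) \<times> (real ^ 'n)"
      obtain u x where "z = (u, x)" by (cases z)
      then show "(INF x. \<phi> x) \<le> f z"
        by (cases "u = 0") (simp_all add: f_0 f_neq INF_lower)
    qed
  qed
  have eps_eq: "eps_argmin \<epsilon> f = {0} \<times> eps_argmin \<epsilon> \<phi>" for \<epsilon>
  proof (rule set_eqI)
    fix z :: "(real ^ 'm) \<times> (real ^ 'n)"
    obtain u x where "z = (u, x)" by (cases z)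
    then show "z \<in> eps_argmin \<epsilon> f \<longleftrightarrow> z \<in> {0} \<times> eps_argmin \<epsilon> \<phi>"
      by (cases "u = 0") (simp_all add: eps_argmin_def edom_def f_0 f_neq inf_eq)
  qed
  have argmin_eq: "argmin f = {0} \<times> argmin \<phi>"
    using eps_eq[of 0] by (simp add: eps_argmin_0)
  obtain m where m: "(INF z. f z) = ereal m"
  proof -
    obtain x0 where "\<phi> x0 < \<infinity>" "\<phi> x0 = (INF x. \<phi> x)"
      using argmin_nonempty by (auto simp: argmin_def edom_def)
    moreover have "\<phi> x0 \<noteq> -\<infinity>" using g0_fin h_fin by (simp add: \<phi>_def)
    ultimately obtain r where "(INF x. \<phi> x) = ereal r"
      by (cases "INF x. \<phi> x") auto
    then show ?thesis using that inf_eq by simp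
  qed
  have ne: "argmin f \<noteq> {}" using argmin_nonempty by (auto simp: argmin_eq)
  have f_lim: "\<exists>\<epsilon>s. (\<forall>\<nu>. \<epsilon>s \<nu> \<ge> 0) \<and> \<epsilon>s \<longlonglongrightarrow> 0 \<and> (0, x0) \<in> LimInn (\<lambda>\<nu>. eps_argmin (\<epsilon>s \<nu>) (fs \<nu>))"
    if lim: "(\<lambda>\<nu>. INF z. fs \<nu> z) \<longlonglongrightarrow> (INF z. f z)" and "x0 \<in> argmin \<phi>" for x0
  proof -
    have "(0, x0) \<in> argmin f" using that(2) by (simp add: argmin_eq)
    from epi_argmin_LimInn[OF epi m lim this] show ?thesis by blast
  qed
  have g_lim: "\<exists>\<epsilon>s. (\<forall>\<nu>. \<epsilon>s \<nu> \<ge> 0) \<and> \<epsilon>s \<longlonglongrightarrow> 0 \<and>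
      Lim_eq (\<lambda>\<nu>. eps_argmin (\<epsilon>s \<nu>) (fs \<nu>)) (argmin f)"
    if lim: "(\<lambda>\<nu>. INF z. fs \<nu> z) \<longlonglongrightarrow> (INF z. f z)"
    by (rule epi_argmin_Lim[OF epi m lim ne]) (intro exI conjI allI)
  show ?thesis
  proof (intro conjI)
    show "\<forall>\<epsilon>\<ge>0. eps_argmin \<epsilon> f = {0} \<times> eps_argmin \<epsilon> \<phi>"
      by (simp add: eps_eq)
    show "\<forall>\<epsilon>s \<epsilon>. (\<forall>\<nu>. \<epsilon>s \<nu> \<ge> 0) \<and> \<epsilon> \<ge> 0 \<and> \<epsilon>s \<longlonglongrightarrow> \<epsilon> \<longrightarrow>
        LimOut (\<lambda>\<nu>. eps_argmin (\<epsilon>s \<nu>) (fs \<nu>)) \<subseteq> eps_argmin \<epsilon> f"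
      by (intro allI impI epi_LimOut_eps_argmin[OF epi m]) simp
    show "\<forall>\<epsilon>s N w. (\<forall>\<nu>. \<epsilon>s \<nu> \<ge> 0) \<and> \<epsilon>s \<longlonglongrightarrow> 0 \<and> infinite N \<and>
        (\<forall>\<nu>\<in>N. w \<nu> \<in> eps_argmin (\<epsilon>s \<nu>) (fs \<nu>)) \<and> (\<exists>z. (w \<longlongrightarrow> z) (along N)) \<longrightarrow>
        ((\<lambda>\<nu>. INF z. fs \<nu> z) \<longlongrightarrow> (INF z. f z)) (along N)"
    proof (intro allI impI, elim conjE exE)
      fix \<epsilon>s N w z
      assume "\<epsilon>s \<longlonglongrightarrow> 0" "\<forall>\<nu>\<in>N. w \<nu> \<in> eps_argmin (\<epsilon>s \<nu>) (fs \<nu>)" "(w \<longlongrightarrow> z) (along N)"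
      then show "((\<lambda>\<nu>. INF z. fs \<nu> z) \<longlongrightarrow> (INF z. f z)) (along N)"
        by (intro epi_inf_tendsto_along[OF epi m]) auto
    qed
    show "(\<lambda>\<nu>. INF z. fs \<nu> z) \<longlonglongrightarrow> (INF z. f z) \<longleftrightarrow> tight_funs fs"
      using epi_inf_tendsto_imp_tight[OF epi m] epi_tight_imp_inf_tendsto[OF epi m] by (rule iffI)
  qed (intro epi inf_eq epi_limsup_inf[OF epi] impI ballI f_lim g_lim; assumption)+
qed

end
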